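(* Let $\alpha:[0,\infty)\to(0,\infty)$ be measurable and locally integrable, let $\alpha^*(t):=\sup_{0\le r\le t}\alpha(r)$, let $X$ be the solution of $dX_t=-\alpha(t)X_t\,dt+dW_t$, $X_0=0$, and let $\mathcal L_t^x$ be its local time. Fix an arbitrary $x\in\mathbb R$. Then (for a suitable modification of $(\mathcal L_t^x)_{t\ge0}$) there is an almost surely finite random constant $C$, independent of $s,t,T\in[0,\infty)$, such that almost surely $$|\mathcal L_t^x-\mathcal L_s^x|\le C\left[|t-s|^{1/2}\sqrt{(T+1)\,\alpha^*(T+1)}+|t-s|^{1/2}\sqrt{\log\frac1{|t-s|}}\ \right]$$ for all $0\le s,t\le T<\infty$ with $|t-s|<1$.
   Context: $W=(W_t)_{t\ge0}$ is a standard one-dimensional Brownian motion on a complete filtered probability space, and $X_t=\int_0^t\exp(-\int_s^t\alpha(u)\,du)\,dW_s$ (continuous version). The local time at level $x$, formally $\mathcal L_t^x=\int_0^t\delta(X_r-x)\,dr$ with $\delta$ the Dirac delta at $0$, is the limit in $L^2$ as $\varepsilon\to0+$ of $\int_0^t p_\varepsilon(X_r-x)\,dr$, where $p_\varepsilon(y)=\frac1{\sqrt{2\pi\varepsilon}}e^{-y^2/(2\varepsilon)}$; $\mathcal L_0^x=0$. Conventions: $|t-s|^{1/2}\sqrt{\log(1/|t-s|)}:=0$ when $s=t$; $\alpha^*$ may take the value $+\infty$, and $0\cdot\infty:=0$. *)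

theory Defs
  imports "HOL-Probability.Probability"
begin

locale complete_filtered_prob_space = prob_space M + complete_measure M
  for M :: "'a measure" +
  fixes F :: "real \<Rightarrow> 'a measure"
  assumes subalgebra_F: "0 \<le> t \<Longrightarrow> subalgebra M (F t)"
    and sets_F_mono: "0 \<le> s \<Longrightarrow> s \<le> t \<Longrightarrow> sets (F s) \<subseteq> sets (F t)"
    and null_sets_F: "null_sets M \<subseteq> sets (F 0)"

definition adapted :: "(real \<Rightarrow> 'a measure) \<Rightarrow> (real \<Rightarrow> 'a \<Rightarrow> real) \<Rightarrow> bool" where
  "adapted F Y \<longleftrightarrow> (\<forall>t\<ge>0. Y t \<in> borel_measurable (F t))"

text \<open>All processes are indexed by \<^typ>\<open>real\<close>; only their values at times \<open>t \<ge> 0\<close> matter.\<close>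

definition brownian_motion ::
    "'a measure \<Rightarrow> (real \<Rightarrow> 'a measure) \<Rightarrow> (real \<Rightarrow> 'a \<Rightarrow> real) \<Rightarrow> bool" where
  "brownian_motion M F W \<longleftrightarrow>
     adapted F W \<and>
     (AE \<omega> in M. W 0 \<omega> = 0) \<and>
     (AE \<omega> in M. continuous_on {0..} (\<lambda>t. W t \<omega>)) \<and>
     (\<forall>s t. 0 \<le> s \<and> s < t \<longrightarrow>
        distributed M lborel (\<lambda>\<omega>. W t \<omega> - W s \<omega>) (normal_density 0 (sqrt (t - s))) \<and>
        prob_space.indep_set M (sets (F s))
          (sets (vimage_algebra (space M) (\<lambda>\<omega>. W t \<omega> - W s \<omega>) borel)))"

text \<open>The equation \<open>dX\<^sub>t = - \<alpha>(t) X\<^sub>t dt + dW\<^sub>t\<close>, \<open>X\<^sub>0 = 0\<close>, in integral form. As the noise is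
  additive, only the Lebesgue integral of the drift is needed; its pathwise unique continuous
  solution is (the continuous version of) the Wiener integral
  \<open>X\<^sub>t = \<integral>\<^sub>0\<^sup>t exp (- \<integral>\<^sub>s\<^sup>t \<alpha>(u) du) dW\<^sub>s\<close>.\<close>

definition sde_solution ::
    "'a measure \<Rightarrow> (real \<Rightarrow> 'a measure) \<Rightarrow> (real \<Rightarrow> 'a \<Rightarrow> real) \<Rightarrow> (real \<Rightarrow> real) \<Rightarrow>
     (real \<Rightarrow> 'a \<Rightarrow> real) \<Rightarrow> bool" where
  "sde_solution M F W \<alpha> X \<longleftrightarrow>
     adapted F X \<and>
     (AE \<omega> in M. X 0 \<omega> = 0) \<and>
     (AE \<omega> in M. continuous_on {0..} (\<lambda>t. X t \<omega>)) \<and>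
     (AE \<omega> in M. \<forall>t\<ge>0. X t \<omega> = - (LINT r:{0..t}|lborel. \<alpha> r * X r \<omega>) + W t \<omega>)"

definition heat_kernel :: "real \<Rightarrow> real \<Rightarrow> real" where
  "heat_kernel \<epsilon> y = 1 / sqrt (2 * pi * \<epsilon>) * exp (- y\<^sup>2 / (2 * \<epsilon>))"

text \<open>The mean square distance is a \<^const>\<open>nn_integral\<close> because a Bochner integral would be \<open>0\<close>
  where the distance is infinite.\<close>

definition local_time ::
    "'a measure \<Rightarrow> (real \<Rightarrow> 'a \<Rightarrow> real) \<Rightarrow> real \<Rightarrow> (real \<Rightarrow> 'a \<Rightarrow> real) \<Rightarrow> bool" where
  "local_time M X x L \<longleftrightarrow>
     (AE \<omega> in M. L 0 \<omega> = 0) \<and>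
     (\<forall>t\<ge>0. L t \<in> borel_measurable M \<and> integrable M (\<lambda>\<omega>. (L t \<omega>)\<^sup>2) \<and>
        ((\<lambda>\<epsilon>. \<integral>\<^sup>+ \<omega>. ennreal (((LINT r:{0..t}|lborel. heat_kernel \<epsilon> (X r \<omega> - x)) - L t \<omega>)\<^sup>2) \<partial>M)
           \<longlongrightarrow> 0) (at_right 0))"

definition modification ::
    "'a measure \<Rightarrow> (real \<Rightarrow> 'a \<Rightarrow> real) \<Rightarrow> (real \<Rightarrow> 'a \<Rightarrow> real) \<Rightarrow> bool" where
  "modification M Y Y' \<longleftrightarrow>
     (\<forall>t\<ge>0. Y' t \<in> borel_measurable M \<and> (AE \<omega> in M. Y' t \<omega> = Y t \<omega>))"

definition running_sup :: "(real \<Rightarrow> real) \<Rightarrow> real \<Rightarrow> ennreal" where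
  "running_sup \<alpha> t = (SUP r\<in>{0..t}. ennreal (\<alpha> r))"

definition esqrt :: "ennreal \<Rightarrow> ennreal" where
  "esqrt y = (if y = \<infinity> then \<infinity> else ennreal (sqrt (enn2real y)))"

end

theory Submission
  imports Defs
begin

text \<open>The Euler scheme of the equation has Gaussian increments, and on an interval on which
  \<open>\<alpha> \<le> A\<close> its limit \<open>X\<close> has conditional densities
  \<open>P(X\<^sub>r \<in> dy | F\<^sub>s) \<le> (1 / sqrt (r - s) + sqrt (2 A)) dy\<close>. Khasminskii's argument turns this
  into the bound \<open>E exp (sqrt \<Lambda> / 8 * (L\<^sub>t - L\<^sub>s)) \<le> 2 exp (\<Lambda> (t - s))\<close> for all \<open>\<Lambda> \<ge> A\<close>. With
  \<open>\<Lambda> = q 2\<^sup>n\<close>, \<open>q = A + n + k\<close>, the exponential moments of the increments over all dyadic intervals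
  of length \<open>2\<^sup>-\<^sup>n\<close> in \<open>[0, k]\<close>, damped by \<open>exp (- 3 q)\<close>, are summable over \<open>k\<close> and \<open>n\<close>, so every
  such increment is at most a random constant times \<open>sqrt (q / 2\<^sup>n)\<close>. Since \<open>L\<close> is increasing,
  an arbitrary increment is dominated by at most two adjacent dyadic ones; and
  \<open>\<alpha>\<^sup>* \<ge> \<alpha> 0 > 0\<close> absorbs \<open>sqrt k\<close> into \<open>sqrt ((T + 1) \<alpha>\<^sup>*)\<close>.\<close>

section \<open>Gaussian convolution\<close>

text \<open>The coefficient \<alpha> is merely measurable and need not be locally bounded, and one
  random constant has to serve every horizon \<open>T\<close>. No stochastic integral is formed: the
  equation is used pathwise, so the Euler scheme converges on each continuous path, and Gaussianity
  enters only through the independent increments of \<open>W\<close>. Conditional estimates are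
  inequalities tested against every nonnegative \<open>F s\<close>-measurable weight
  \<open>Z\<close>; a weight can absorb what has been observed, which makes restarting at a later
  time and iterating over visit times immediate. The exponent \<Lambda> stays free so that it can be
  adapted to the interval: on length 2^-n, the choice \<Lambda> = q 2^n turns exp (\<Lambda> (t -
  s)) into exp q. Of the damping 3 q, one q cancels this factor and the other two beat the number k
  2^n of intervals. The summand n of q, at the scale of |t - s|, is the source of log (1 / |t - s|).
  Since the local time is monotone, a single scale suffices and no chaining series is
  summed.\<close>

lemma heat_kernel_eq_normal_density:
  assumes "0 < v"
  shows "heat_kernel v y = normal_density 0 (sqrt v) y"
  using assms by (simp add: heat_kernel_def normal_density_def)

lemma heat_kernel_nonneg: "0 \<le> v \<Longrightarrow> 0 \<le> heat_kernel v y"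
  by (simp add: heat_kernel_def)

lemma heat_kernel_le:
  assumes "0 < u" "u \<le> v"
  shows "heat_kernel v y \<le> 1 / sqrt (2 * pi * u)"
proof -
  have "heat_kernel v y \<le> 1 / sqrt (2 * pi * v) * 1"
    unfolding heat_kernel_def using assms by (intro mult_left_mono) auto
  also have "\<dots> \<le> 1 / sqrt (2 * pi * u)"
    using assms by (auto intro!: divide_left_mono mult_pos_pos)
  finally show ?thesis .
qed

lemma continuous_on_heat_kernel [continuous_intros]:
  assumes "continuous_on S f"
  shows "continuous_on S (\<lambda>z. heat_kernel v (f z))"
  \<comment> \<open>Written as multiplication by a constant inverse, the division is continuous for
    every \<open>v\<close>, including \<open>v = 0\<close>.\<close>
  unfolding heat_kernel_def divide_inverse using assms by (intro continuous_intros)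

lemma borel_measurable_heat_kernel [measurable]: "heat_kernel v \<in> borel_measurable borel"
  by (intro borel_measurable_continuous_onI continuous_intros)

text \<open>Semigroup property of the heat kernel: its parameter is a variance, and variances of
  independent centred Gaussians add.\<close>

lemma heat_kernel_convolution:
  assumes "0 < v" "0 < \<sigma>"
  shows "(\<integral>\<^sup>+y. ennreal (heat_kernel v (b - y)) * ennreal (normal_density 0 \<sigma> y) \<partial>lborel)
    = heat_kernel (v + \<sigma>\<^sup>2) b"
proof -
  have "(\<integral>\<^sup>+y. ennreal (heat_kernel v (b - y)) * ennreal (normal_density 0 \<sigma> y) \<partial>lborel)
    = (\<integral>\<^sup>+y. ennreal (normal_density 0 (sqrt v) (b - y) * normal_density 0 \<sigma> y) \<partial>lborel)"
    using assms by (intro nn_integral_cong) (simp add: heat_kernel_eq_normal_density ennreal_mult)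
  also have "\<dots> = normal_density 0 (sqrt ((sqrt v)\<^sup>2 + \<sigma>\<^sup>2)) b"
    using fun_cong[OF conv_normal_density_zero_mean[of "sqrt v" \<sigma>]] assms by simp
  also have "\<dots> = heat_kernel (v + \<sigma>\<^sup>2) b"
    using assms by (simp add: heat_kernel_eq_normal_density add_pos_pos)
  finally show ?thesis .
qed

text \<open>Given \<open>G\<close>, the variable \<open>w * D\<close> is an independent centred
  Gaussian of variance \<open>w\<^sup>2 * \<sigma>\<^sup>2\<close>, so integrating it out convolves
  the kernel. The weight \<open>Z\<close> makes this a conditional statement.\<close>

lemma (in prob_space) nn_integral_indep_heat_kernel:
  assumes sub: "subalgebra M G"
    and Z [measurable]: "Z \<in> borel_measurable G" and B [measurable]: "B \<in> borel_measurable G"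
    and Z_nonneg: "\<And>\<omega>. 0 \<le> Z \<omega>"
    and D: "distributed M lborel D (normal_density 0 \<sigma>)"
    and ind: "indep_set (sets G) (sets (vimage_algebra (space M) D borel))"
    and pos: "0 < \<sigma>" "0 < v" "w \<noteq> 0"
  shows "(\<integral>\<^sup>+\<omega>. ennreal (Z \<omega> * heat_kernel v (B \<omega> + w * D \<omega>)) \<partial>M)
    = (\<integral>\<^sup>+\<omega>. ennreal (Z \<omega> * heat_kernel (v + w\<^sup>2 * \<sigma>\<^sup>2) (B \<omega>)) \<partial>M)"
proof -
  \<comment> \<open>The identity as a map from \<open>M\<close> to \<open>G\<close> treats the
    sub-\<sigma>-algebra as a random element; independence then says that its joint law with
    \<open>D'\<close> is a product.\<close>
  have meas_id [measurable]: "(\<lambda>\<omega>. \<omega>) \<in> M \<rightarrow>\<^sub>M G"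
    using sub by (auto simp: subalgebra_def measurable_def dest: sets.sets_into_space)
  have D_meas [measurable]: "D \<in> borel_measurable M"
    using distributed_measurable[OF D] by simp
  have spG: "space G = space M" using sub by (simp add: subalgebra_def)
  \<comment> \<open>The sign turns \<open>B + w * D\<close> into \<open>B - D'\<close>, the form of
    a convolution.\<close>
  define D' where "D' \<omega> = 0 + (-w) * D \<omega>" for \<omega>
  have D'_meas [measurable]: "D' \<in> borel_measurable M" unfolding D'_def by measurable
  have D': "distributed M lborel D' (normal_density 0 (\<bar>w\<bar> * \<sigma>))"
    using normal_density_affine[OF D pos(1), of "-w" 0] pos(3) unfolding D'_def[abs_def] by simp
  interpret G: prob_space "distr M G (\<lambda>\<omega>. \<omega>)" by (rule prob_space_distr) measurable
  interpret D': prob_space "distr M borel D'" by (rule prob_space_distr) measurable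
  have joint: "distr M G (\<lambda>\<omega>. \<omega>) \<Otimes>\<^sub>M distr M borel D'
      = distr M (G \<Otimes>\<^sub>M borel) (\<lambda>\<omega>. (\<omega>, D' \<omega>))"
  proof (rule pair_measure_eqI)
    fix A and B :: "real set"
    assume "A \<in> sets (distr M G (\<lambda>\<omega>. \<omega>))" "B \<in> sets (distr M borel D')"
    then have A [measurable]: "A \<in> sets G" and B [measurable]: "B \<in> sets borel" by auto
    have A_M: "A \<in> events" using A sub by (auto simp: subalgebra_def)
    have D'B: "D' -` B \<inter> space M \<in> sets (vimage_algebra (space M) D borel)"
    proof -
      have "D' -` B \<inter> space M = D -` ((\<lambda>y. 0 + (-w) * y) -` B \<inter> space borel) \<inter> space M"
        by (auto simp: D'_def)
      moreover have "(\<lambda>y. 0 + (-w) * y) -` B \<inter> space borel \<in> sets borel"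
        by measurable
      ultimately show ?thesis
        by (metis in_vimage_algebra)
    qed
    have "emeasure (distr M G (\<lambda>\<omega>. \<omega>)) A * emeasure (distr M borel D') B
        = emeasure M A * emeasure M (D' -` B \<inter> space M)"
      using sets.sets_into_space[OF A] spG by (simp add: emeasure_distr Int_absorb2)
    also have "\<dots> = ennreal (prob A * prob (D' -` B \<inter> space M))"
      by (simp add: emeasure_eq_measure ennreal_mult)
    also have "prob A * prob (D' -` B \<inter> space M) = prob (A \<inter> (D' -` B \<inter> space M))"
      using indep_setD[OF ind A D'B] by simp
    also have "A \<inter> (D' -` B \<inter> space M) = (\<lambda>\<omega>. (\<omega>, D' \<omega>)) -` (A \<times> B) \<inter> space M"
      by auto
    also have "ennreal (prob \<dots>) = emeasure (distr M (G \<Otimes>\<^sub>M borel) (\<lambda>\<omega>. (\<omega>, D' \<omega>))) (A \<times> B)"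
      by (subst emeasure_distr) (auto simp: emeasure_eq_measure)
    finally show "emeasure (distr M G (\<lambda>\<omega>. \<omega>)) A * emeasure (distr M borel D') B = \<dots>" .
  qed (auto intro: G.sigma_finite_measure_axioms D'.sigma_finite_measure_axioms cong: sets_pair_measure_cong)
  have dens: "distr M borel D' = density lborel (normal_density 0 (\<bar>w\<bar> * \<sigma>))"
    using D' by (simp add: distributed_def cong: distr_cong)
  have "(\<integral>\<^sup>+\<omega>. ennreal (Z \<omega> * heat_kernel v (B \<omega> + w * D \<omega>)) \<partial>M)
    = (\<integral>\<^sup>+p. ennreal (Z (fst p) * heat_kernel v (B (fst p) - snd p))
        \<partial>distr M (G \<Otimes>\<^sub>M borel) (\<lambda>\<omega>. (\<omega>, D' \<omega>)))"
    by (subst nn_integral_distr) (auto simp: D'_def)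
  also have "\<dots> = (\<integral>\<^sup>+p. ennreal (Z (fst p) * heat_kernel v (B (fst p) - snd p))
        \<partial>(distr M G (\<lambda>\<omega>. \<omega>) \<Otimes>\<^sub>M distr M borel D'))"
    by (simp only: joint)
  also have "\<dots> = (\<integral>\<^sup>+\<omega>. \<integral>\<^sup>+y. ennreal (Z \<omega> * heat_kernel v (B \<omega> - y)) \<partial>distr M borel D'
      \<partial>distr M G (\<lambda>\<omega>. \<omega>))"
    by (subst D'.nn_integral_fst[symmetric]) auto
  also have "\<dots> = (\<integral>\<^sup>+\<omega>. \<integral>\<^sup>+y. ennreal (Z \<omega> * heat_kernel v (B \<omega> - y)) \<partial>distr M borel D' \<partial>M)"
    by (subst nn_integral_distr) (auto)
  also have "\<dots> = (\<integral>\<^sup>+\<omega>. ennreal (Z \<omega> * heat_kernel (v + w\<^sup>2 * \<sigma>\<^sup>2) (B \<omega>)) \<partial>M)"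
  proof (intro nn_integral_cong)
    fix \<omega>
    have "(\<integral>\<^sup>+y. ennreal (Z \<omega> * heat_kernel v (B \<omega> - y)) \<partial>distr M borel D')
      = (\<integral>\<^sup>+y. ennreal (Z \<omega>) * (ennreal (heat_kernel v (B \<omega> - y)) * ennreal (normal_density 0 (\<bar>w\<bar> * \<sigma>) y)) \<partial>lborel)"
      unfolding dens using Z_nonneg pos
      by (subst nn_integral_density) (auto intro!: nn_integral_cong simp: ennreal_mult heat_kernel_nonneg mult_ac)
    also have "\<dots> = ennreal (Z \<omega>) * ennreal (heat_kernel (v + (\<bar>w\<bar> * \<sigma>)\<^sup>2) (B \<omega>))"
      using pos by (subst nn_integral_cmult) (auto simp: heat_kernel_convolution)
    also have "\<dots> = ennreal (Z \<omega> * heat_kernel (v + w\<^sup>2 * \<sigma>\<^sup>2) (B \<omega>))"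
      using Z_nonneg pos by (simp add: ennreal_mult heat_kernel_nonneg power_mult_distrib)
    finally show "(\<integral>\<^sup>+y. ennreal (Z \<omega> * heat_kernel v (B \<omega> - y)) \<partial>distr M borel D') = \<dots>" .
  qed
  finally show ?thesis .
qed

section \<open>The Euler scheme\<close>

text \<open>On each step the path is frozen at the left end while \<alpha> is integrated exactly,
  since point values of a merely integrable \<alpha> say nothing about its integral.\<close>

primrec euler :: "(real \<Rightarrow> real) \<Rightarrow> (real \<Rightarrow> real) \<Rightarrow> real \<Rightarrow> real \<Rightarrow> real \<Rightarrow> nat \<Rightarrow> real" where
  "euler \<alpha> w y s h 0 = y"
| "euler \<alpha> w y s h (Suc j) =
     (1 - (LINT u:{s + real j * h<..s + real (Suc j) * h}|lborel. \<alpha> u)) * euler \<alpha> w y s h j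
     + (w (s + real (Suc j) * h) - w (s + real j * h))"

lemma set_integrable_mult_continuous:
  fixes \<alpha> f :: "real \<Rightarrow> real"
  assumes "set_integrable lborel {a..b} \<alpha>" and "continuous_on {a..b} f"
  shows "set_integrable lborel {a..b} (\<lambda>u. \<alpha> u * f u)"
proof -
  have "bounded (f ` {a..b})"
    using assms(2) by (intro compact_imp_bounded compact_continuous_image) auto
  then obtain K where "\<forall>y\<in>f ` {a..b}. norm y \<le> K"
    unfolding bounded_iff by blast
  then have K: "\<And>u. u \<in> {a..b} \<Longrightarrow> \<bar>f u\<bar> \<le> K" by auto
  have f_meas: "(\<lambda>u. indicator {a..b} u *\<^sub>R f u) \<in> borel_measurable borel"
    using assms(2) by (intro borel_measurable_continuous_on_indicator) auto
  have a_int: "integrable lborel (\<lambda>u. indicator {a..b} u *\<^sub>R \<alpha> u)"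
    using assms(1) by (simp add: set_integrable_def)
  have "integrable lborel (\<lambda>u. K * (indicator {a..b} u *\<^sub>R \<alpha> u))"
    using a_int by simp
  then have "integrable lborel (\<lambda>u. (indicator {a..b} u *\<^sub>R \<alpha> u) * (indicator {a..b} u *\<^sub>R f u))"
  proof (rule Bochner_Integration.integrable_bound)
    show "(\<lambda>u. (indicator {a..b} u *\<^sub>R \<alpha> u) * (indicator {a..b} u *\<^sub>R f u)) \<in> borel_measurable lborel"
      using f_meas borel_measurable_integrable[OF a_int] by simp
    show "AE u in lborel. norm ((indicator {a..b} u *\<^sub>R \<alpha> u) * (indicator {a..b} u *\<^sub>R f u))
      \<le> norm (K * (indicator {a..b} u *\<^sub>R \<alpha> u))"
    proof (intro AE_I2)
      fix u show "norm ((indicator {a..b} u *\<^sub>R \<alpha> u) * (indicator {a..b} u *\<^sub>R f u))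
        \<le> norm (K * (indicator {a..b} u *\<^sub>R \<alpha> u))"
        using K[of u] mult_right_mono[of "\<bar>f u\<bar>" K "\<bar>\<alpha> u\<bar>"]
        by (auto simp: indicator_def abs_mult mult.commute)
    qed
  qed
  also have "(\<lambda>u. (indicator {a..b} u *\<^sub>R \<alpha> u) * (indicator {a..b} u *\<^sub>R f u))
    = (\<lambda>u. indicator {a..b} u *\<^sub>R (\<alpha> u * f u))"
    by (auto simp: indicator_def)
  finally show ?thesis by (simp add: set_integrable_def)
qed

lemma set_integral_Icc_split:
  fixes f :: "real \<Rightarrow> real"
  assumes "set_integrable lborel {c..b} f" "c \<le> a" "a \<le> b"
  shows "(LINT u:{c..b}|lborel. f u) = (LINT u:{c..a}|lborel. f u) + (LINT u:{a<..b}|lborel. f u)"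
proof -
  have "{c..b} = {c..a} \<union> {a<..b}" using assms by auto
  moreover have "(LINT u:{c..a} \<union> {a<..b}|lborel. f u)
      = (LINT u:{c..a}|lborel. f u) + (LINT u:{a<..b}|lborel. f u)"
    using assms by (intro set_integral_Un set_integrable_subset[OF assms(1)]) auto
  ultimately show ?thesis by simp
qed

lemma set_integral_Ioc_bound:
  fixes f :: "real \<Rightarrow> real"
  assumes "set_integrable lborel {a<..b} f" "a \<le> b" "\<And>u. u \<in> {a<..b} \<Longrightarrow> \<bar>f u\<bar> \<le> K"
  shows "\<bar>LINT u:{a<..b}|lborel. f u\<bar> \<le> K * (b - a)"
proof -
  have cst: "set_integrable lborel {a<..b} (\<lambda>u. K)"
    using assms by (simp add: set_integrable_def)
  have "\<bar>LINT u:{a<..b}|lborel. f u\<bar> \<le> (LINT u:{a<..b}|lborel. \<bar>f u\<bar>)"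
    using set_integral_norm_bound[OF assms(1)] by simp
  also have "\<dots> \<le> (LINT u:{a<..b}|lborel. K)"
    using assms by (intro set_integral_mono set_integrable_abs cst) auto
  also have "\<dots> = K * (b - a)"
    using assms by (simp add: set_lebesgue_integral_def)
  finally show ?thesis .
qed

text \<open>One step multiplies the old error by \<open>1 - G\<close>, which lies in [0, 1] because
  \<open>A * h \<le> 1\<close>, and adds the error of freezing \<open>f\<close> at the left end, at
  most \<open>e * A * h\<close>. Errors therefore only add up, and no Gronwall factor
  appears.\<close>

lemma euler_error:
  fixes \<alpha> f w :: "real \<Rightarrow> real"
  assumes s: "0 \<le> s" "0 \<le> h" and A: "\<And>u. 0 \<le> u \<Longrightarrow> u \<le> r \<Longrightarrow> 0 \<le> \<alpha> u \<and> \<alpha> u \<le> A"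
    and int: "set_integrable lborel {0..r} \<alpha>"
    and cont: "continuous_on {0..r} f"
    and eq: "\<And>t. 0 \<le> t \<Longrightarrow> t \<le> r \<Longrightarrow> f t = - (LINT u:{0..t}|lborel. \<alpha> u * f u) + w t"
    and osc: "\<And>u v. u \<in> {0..r} \<Longrightarrow> v \<in> {0..r} \<Longrightarrow> \<bar>u - v\<bar> \<le> h \<Longrightarrow> \<bar>f u - f v\<bar> \<le> e"
    and h: "A * h \<le> 1" and e: "0 \<le> e"
    and j: "s + real j * h \<le> r"
  shows "\<bar>f (s + real j * h) - euler \<alpha> w (f s) s h j\<bar> \<le> e * A * (real j * h)"
  using j
proof (induction j)
  case (Suc j)
  define a b where "a = s + real j * h" and "b = s + real (Suc j) * h"
  define G where "G = (LINT u:{a<..b}|lborel. \<alpha> u)"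
  define E where "E = euler \<alpha> w (f s) s h j"
  have ba: "b - a = h" unfolding a_def b_def by (simp add: algebra_simps)
  have ab: "0 \<le> a" "a \<le> b" "b \<le> r"
    using Suc.prems s by (auto simp: a_def b_def algebra_simps)
  have IH: "\<bar>f a - E\<bar> \<le> e * A * (real j * h)"
    using Suc ab by (auto simp: a_def E_def)
  have A0: "0 \<le> A" using A[of 0] ab by auto
  have int_ab: "set_integrable lborel {a<..b} \<alpha>"
    using ab by (intro set_integrable_subset[OF int]) auto
  have int_f: "set_integrable lborel {0..r} (\<lambda>u. \<alpha> u * f u)"
    by (rule set_integrable_mult_continuous[OF int cont])
  have int_f_ab: "set_integrable lborel {a<..b} (\<lambda>u. \<alpha> u * f u)"
    using ab by (intro set_integrable_subset[OF int_f]) auto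
  have int_f_b: "set_integrable lborel {0..b} (\<lambda>u. \<alpha> u * f u)"
    using ab by (intro set_integrable_subset[OF int_f]) auto
  have int_fa: "set_integrable lborel {a<..b} (\<lambda>u. \<alpha> u * f a)"
    using int_ab by (simp add: set_integrable_mult_left)
  have G: "0 \<le> G" "G \<le> 1"
  proof -
    show "0 \<le> G" unfolding G_def set_lebesgue_integral_def using A ab
      by (intro Bochner_Integration.integral_nonneg) (auto simp: indicator_def)
    have "\<bar>G\<bar> \<le> A * (b - a)" unfolding G_def using A ab
      by (intro set_integral_Ioc_bound int_ab) auto
    then show "G \<le> 1" using h ba by auto
  qed
  define R where "R = (LINT u:{a<..b}|lborel. \<alpha> u * f u - \<alpha> u * f a)"
  have R_eq: "R = (LINT u:{a<..b}|lborel. \<alpha> u * f u) - G * f a"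
    unfolding R_def G_def by (simp add: set_integral_diff(2)[OF int_f_ab int_fa])
  have "\<bar>R\<bar> \<le> (A * e) * (b - a)"
    unfolding R_def
  proof (intro set_integral_Ioc_bound ab)
    show "set_integrable lborel {a<..b} (\<lambda>u. \<alpha> u * f u - \<alpha> u * f a)"
      by (rule set_integral_diff(1)[OF int_f_ab int_fa])
    fix u assume u: "u \<in> {a<..b}"
    have "\<bar>\<alpha> u * f u - \<alpha> u * f a\<bar> = \<bar>\<alpha> u\<bar> * \<bar>f u - f a\<bar>"
      by (simp add: abs_mult[symmetric] algebra_simps)
    also have "\<dots> \<le> A * e"
      using A[of u] osc[of u a] ab u ba by (intro mult_mono) auto
    finally show "\<bar>\<alpha> u * f u - \<alpha> u * f a\<bar> \<le> A * e" .
  qed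
  then have R_le: "\<bar>R\<bar> \<le> e * A * h" using ba by (simp add: mult_ac)
  have "f b - f a = w b - w a - (LINT u:{a<..b}|lborel. \<alpha> u * f u)"
    using eq[of a] eq[of b] ab set_integral_Icc_split[OF int_f_b ab(1,2)] by simp
  then have "f b = (1 - G) * f a + (w b - w a) - R"
    using R_eq by (simp add: algebra_simps)
  then have "f b - ((1 - G) * E + (w b - w a)) = (1 - G) * (f a - E) - R"
    by (simp add: algebra_simps)
  then have "\<bar>f b - ((1 - G) * E + (w b - w a))\<bar> \<le> \<bar>(1 - G) * (f a - E)\<bar> + \<bar>R\<bar>"
    by linarith
  also have "\<dots> \<le> \<bar>f a - E\<bar> + e * A * h"
    using G R_le by (intro add_mono) (auto simp: abs_mult intro!: mult_left_le_one_le)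
  also have "\<dots> \<le> e * A * (real (Suc j) * h)"
    using IH by (simp add: algebra_simps)
  finally show ?case
    by (simp add: a_def b_def E_def G_def)
qed simp

lemma euler_tendsto:
  fixes \<alpha> f w :: "real \<Rightarrow> real"
  assumes s: "0 \<le> s" "s \<le> r" and A: "\<And>u. 0 \<le> u \<Longrightarrow> u \<le> r \<Longrightarrow> 0 \<le> \<alpha> u \<and> \<alpha> u \<le> A"
    and int: "set_integrable lborel {0..r} \<alpha>"
    and cont: "continuous_on {0..r} f"
    and eq: "\<And>t. 0 \<le> t \<Longrightarrow> t \<le> r \<Longrightarrow> f t = - (LINT u:{0..t}|lborel. \<alpha> u * f u) + w t"
  shows "(\<lambda>N. euler \<alpha> w (f s) s ((r - s) / real N) N) \<longlonglongrightarrow> f r"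
proof (rule LIMSEQ_I)
  fix e :: real assume e: "0 < e"
  have A0: "0 \<le> A" using A[of 0] s by auto
  \<comment> \<open>The total error will be at most \<open>e' * (A * (r - s))\<close>; the summand 1
    keeps the quotient defined and the final inequality strict.\<close>
  define e' where "e' = e / (A * (r - s) + 1)"
  have Ars: "0 \<le> A * (r - s)" using A0 s by simp
  have e': "0 < e'" using e Ars by (simp add: e'_def)
  have "uniformly_continuous_on {0..r} f"
    by (rule compact_uniformly_continuous[OF cont]) auto
  then obtain d where d: "0 < d"
    "\<And>u v. u \<in> {0..r} \<Longrightarrow> v \<in> {0..r} \<Longrightarrow> \<bar>u - v\<bar> < d \<Longrightarrow> \<bar>f u - f v\<bar> < e'"
    unfolding uniformly_continuous_on_def using e' by (metis dist_real_def)
  have lim: "(\<lambda>N. (r - s) / real N) \<longlonglongrightarrow> 0"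
    by (rule lim_const_over_n)
  have "\<forall>\<^sub>F N in sequentially. (r - s) / real N < d"
    using order_tendstoD(2)[OF lim d(1)] .
  \<comment> \<open>A step below \<open>1 / (A + 1)\<close> secures \<open>A * h \<le> 1\<close>,
    the condition of \<open>euler_error\<close>.\<close>
  moreover have "\<forall>\<^sub>F N in sequentially. (r - s) / real N < 1 / (A + 1)"
    using A0 by (intro order_tendstoD(2)[OF lim]) auto
  ultimately have "\<forall>\<^sub>F N in sequentially. norm (euler \<alpha> w (f s) s ((r - s) / real N) N - f r) < e"
    using eventually_gt_at_top[of 0]
  proof eventually_elim
    case (elim N)
    let ?h = "(r - s) / real N"
    have end_eq: "s + real N * ?h = r" using elim by simp
    have "A * ?h \<le> A * (1 / (A + 1))" using elim A0 by (intro mult_left_mono) auto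
    also have "\<dots> \<le> 1" using A0 by simp
    finally have Ah: "A * ?h \<le> 1" .
    have "\<bar>f (s + real N * ?h) - euler \<alpha> w (f s) s ?h N\<bar> \<le> e' * A * (real N * ?h)"
    proof (rule euler_error[where r=r])
      show "\<bar>f u - f v\<bar> \<le> e'" if "u \<in> {0..r}" "v \<in> {0..r}" "\<bar>u - v\<bar> \<le> ?h" for u v
        using d(2)[OF that(1,2)] that elim by simp
    qed (use s A int cont eq Ah e' end_eq in auto)
    then have "\<bar>f r - euler \<alpha> w (f s) s ?h N\<bar> \<le> e' * (A * (r - s))"
      unfolding end_eq using elim by (simp add: mult_ac)
    also have "\<dots> < e"
      using e Ars by (simp add: e'_def field_simps)
    finally show ?case by (simp add: abs_minus_commute)
  qed
  then show "\<exists>no. \<forall>N\<ge>no. norm (euler \<alpha> w (f s) s ((r - s) / real N) N - f r) < e"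
    by (simp add: eventually_sequentially)
qed

section \<open>Conditional density bound\<close>

text \<open>Weierstrass's product inequality. The product bounds from below the factor by which the
  drift contracts any noise increment of the Euler scheme.\<close>

lemma prod_one_minus_ge:
  fixes a :: "nat \<Rightarrow> real"
  assumes "\<And>i. i < n \<Longrightarrow> 0 \<le> a i \<and> a i \<le> 1"
  shows "1 - (\<Sum>i<n. a i) \<le> (\<Prod>i<n. 1 - a i)"
  using assms
proof (induction n)
  case (Suc n)
  have "1 - (\<Sum>i<Suc n. a i) \<le> (\<Prod>i<n. 1 - a i) - a n"
    using Suc by fastforce
  also have "\<dots> \<le> (\<Prod>i<n. 1 - a i) - (\<Prod>i<n. 1 - a i) * a n"
  proof -
    have "(\<Prod>i<n. 1 - a i) \<le> 1" using Suc.prems by (intro prod_le_1) auto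
    then show ?thesis using Suc.prems[of n] mult_right_mono[of "\<Prod>i<n. 1 - a i" 1 "a n"] by simp
  qed
  finally show ?case by (simp add: algebra_simps)
qed simp

text \<open>Continuity is required of every path and on the whole line, and measurability of
  \<open>X t\<close> also at negative times, so that joint measurability in time and chance needs no
  exceptional null set. The final theorem brings an arbitrary solution into this form.\<close>

locale linear_drift_diffusion = prob_space M
  for M :: "'a measure" +
  fixes F :: "real \<Rightarrow> 'a measure" and W X :: "real \<Rightarrow> 'a \<Rightarrow> real" and \<alpha> :: "real \<Rightarrow> real"
  assumes subalgebra_F: "0 \<le> t \<Longrightarrow> subalgebra M (F t)"
    and sets_F_mono: "0 \<le> s \<Longrightarrow> s \<le> t \<Longrightarrow> sets (F s) \<subseteq> sets (F t)"
    and W_adapted: "0 \<le> t \<Longrightarrow> W t \<in> borel_measurable (F t)"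
    and W_increment: "0 \<le> s \<Longrightarrow> s < t \<Longrightarrow>
      distributed M lborel (\<lambda>\<omega>. W t \<omega> - W s \<omega>) (normal_density 0 (sqrt (t - s)))"
    and W_indep: "0 \<le> s \<Longrightarrow> s < t \<Longrightarrow>
      indep_set (sets (F s)) (sets (vimage_algebra (space M) (\<lambda>\<omega>. W t \<omega> - W s \<omega>) borel))"
    and \<alpha>_pos: "0 \<le> t \<Longrightarrow> 0 < \<alpha> t"
    and \<alpha>_integrable: "0 \<le> t \<Longrightarrow> set_integrable lborel {0..t} \<alpha>"
    and X_adapted: "0 \<le> t \<Longrightarrow> X t \<in> borel_measurable (F t)"
    and X_measurable [measurable]: "X t \<in> borel_measurable M"
    and X_continuous: "\<And>\<omega>. continuous_on UNIV (\<lambda>t. X t \<omega>)"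
    and X_eq: "AE \<omega> in M. \<forall>t\<ge>0. X t \<omega> = - (LINT r:{0..t}|lborel. \<alpha> r * X r \<omega>) + W t \<omega>"
begin

lemma \<alpha>_nonneg: "0 \<le> t \<Longrightarrow> 0 \<le> \<alpha> t"
  using \<alpha>_pos less_imp_le by blast

lemma measurable_F_mono:
  assumes "f \<in> measurable (F s) N" "0 \<le> s" "s \<le> t"
  shows "f \<in> measurable (F t) N"
proof -
  have "space (F s) = space (F t)"
    using subalgebra_F[of s] subalgebra_F[of t] assms by (simp add: subalgebra_def)
  with assms(1) sets_F_mono[OF assms(2,3)] show ?thesis
    by (auto simp: measurable_def)
qed

lemma measurable_F_M:
  assumes "f \<in> measurable (F t) N" "0 \<le> t"
  shows "f \<in> measurable M N"
  using measurable_from_subalg[OF subalgebra_F assms(1)] assms(2) by simp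

lemma euler_adapted:
  assumes "0 \<le> s" "0 \<le> h"
  shows "(\<lambda>\<omega>. euler \<alpha> (\<lambda>t. W t \<omega>) (X s \<omega>) s h j) \<in> borel_measurable (F (s + real j * h))"
proof (induction j)
  case 0
  then show ?case using X_adapted[OF assms(1)] by simp
next
  case (Suc j)
  have le: "0 \<le> s + real j * h" "s + real j * h \<le> s + real (Suc j) * h"
    using assms by (auto simp: algebra_simps)
  have [measurable]: "(\<lambda>\<omega>. euler \<alpha> (\<lambda>t. W t \<omega>) (X s \<omega>) s h j) \<in> borel_measurable (F (s + real (Suc j) * h))"
    "W (s + real j * h) \<in> borel_measurable (F (s + real (Suc j) * h))"
    "W (s + real (Suc j) * h) \<in> borel_measurable (F (s + real (Suc j) * h))"
    using measurable_F_mono[OF Suc le] measurable_F_mono[OF W_adapted[OF le(1)] le] W_adapted[of "s + real (Suc j) * h"] le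
    by auto
  show ?case unfolding euler.simps by measurable
qed

definition drift :: "real \<Rightarrow> real \<Rightarrow> nat \<Rightarrow> real" where
  "drift s h i = (LINT u:{s + real i * h<..s + real (Suc i) * h}|lborel. \<alpha> u)"

text \<open>Each step of the Euler scheme convolves the conditional law with an independent centred
  Gaussian, so the conditional law stays Gaussian and only its variance matters.\<close>

lemma euler_density_bound:
  assumes s: "0 \<le> s" "0 < h"
    and Z: "Z \<in> borel_measurable (F s)" "\<And>\<omega>. 0 \<le> Z \<omega>"
    and drift: "\<And>i. i < j \<Longrightarrow> 0 \<le> drift s h i \<and> drift s h i < 1"
    and pos: "0 < v" "0 < w"
  shows "(\<integral>\<^sup>+\<omega>. ennreal (Z \<omega> * heat_kernel v (w * euler \<alpha> (\<lambda>t. W t \<omega>) (X s \<omega>) s h j - x)) \<partial>M)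
    \<le> ennreal (1 / sqrt (2 * pi * (v + w\<^sup>2 * (real j * h) * (\<Prod>i<j. 1 - drift s h i)\<^sup>2)))
        * (\<integral>\<^sup>+\<omega>. ennreal (Z \<omega>) \<partial>M)"
  using drift pos
\<comment> \<open>Integrating out the last increment replaces \<open>v\<close> by
  \<open>v + w\<^sup>2 * h\<close> and \<open>w\<close> by \<open>w * (1 - drift s h j)\<close>, so
  both parameters must vary.\<close>
proof (induction j arbitrary: v w)
  case 0
  have [measurable]: "Z \<in> borel_measurable M" using measurable_F_M[OF Z(1) s(1)] .
  have "(\<integral>\<^sup>+\<omega>. ennreal (Z \<omega> * heat_kernel v (w * X s \<omega> - x)) \<partial>M)
    \<le> (\<integral>\<^sup>+\<omega>. ennreal (1 / sqrt (2 * pi * v)) * ennreal (Z \<omega>) \<partial>M)"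
  proof (intro nn_integral_mono)
    fix \<omega>
    have "Z \<omega> * heat_kernel v (w * X s \<omega> - x) \<le> Z \<omega> * (1 / sqrt (2 * pi * v))"
      using Z(2) 0 by (intro mult_left_mono heat_kernel_le) auto
    then show "ennreal (Z \<omega> * heat_kernel v (w * X s \<omega> - x)) \<le> ennreal (1 / sqrt (2 * pi * v)) * ennreal (Z \<omega>)"
      using 0 Z(2) by (subst ennreal_mult[symmetric]) (auto intro!: ennreal_leI simp: mult.commute)
  qed
  then show ?case by (simp add: nn_integral_cmult)
next
  case (Suc j)
  define c where "c = 1 - drift s h j"
  define a b where "a = s + real j * h" and "b = s + real (Suc j) * h"
  define E where "E \<omega> = euler \<alpha> (\<lambda>t. W t \<omega>) (X s \<omega>) s h j" for \<omega>
  define P where "P = (\<Prod>i<j. 1 - drift s h i)"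
  have c: "0 < c" "c \<le> 1" using Suc.prems(1)[of j] by (auto simp: c_def)
  have P: "0 \<le> P" "P \<le> 1" unfolding P_def using Suc.prems(1)
    by (auto intro!: prod_nonneg prod_le_1 simp: less_imp_le)
  have ab: "0 \<le> a" "s \<le> a" "a < b" and ba: "b - a = h"
    using s by (auto simp: a_def b_def algebra_simps)
  have [measurable]: "Z \<in> borel_measurable (F a)" "E \<in> borel_measurable (F a)"
    using measurable_F_mono[OF Z(1) s(1) ab(2)] euler_adapted[of s h j] s
    by (auto simp: a_def E_def[abs_def])
  have "(\<integral>\<^sup>+\<omega>. ennreal (Z \<omega> * heat_kernel v (w * euler \<alpha> (\<lambda>t. W t \<omega>) (X s \<omega>) s h (Suc j) - x)) \<partial>M)
    = (\<integral>\<^sup>+\<omega>. ennreal (Z \<omega> * heat_kernel v ((w * c * E \<omega> - x) + w * (W b \<omega> - W a \<omega>))) \<partial>M)"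
    by (simp add: a_def b_def c_def E_def drift_def algebra_simps)
  also have "\<dots> = (\<integral>\<^sup>+\<omega>. ennreal (Z \<omega> * heat_kernel (v + w\<^sup>2 * (sqrt (b - a))\<^sup>2) (w * c * E \<omega> - x)) \<partial>M)"
    using ab Suc.prems Z(2)
    by (intro nn_integral_indep_heat_kernel[where G="F a"] subalgebra_F W_increment W_indep) auto
  also have "\<dots> = (\<integral>\<^sup>+\<omega>. ennreal (Z \<omega> * heat_kernel (v + w\<^sup>2 * h) ((w * c) * E \<omega> - x)) \<partial>M)"
    using ba s by simp
  also have "\<dots> \<le> ennreal (1 / sqrt (2 * pi * (v + w\<^sup>2 * h + (w * c)\<^sup>2 * (real j * h) * P\<^sup>2)))
        * (\<integral>\<^sup>+\<omega>. ennreal (Z \<omega>) \<partial>M)"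
    unfolding E_def P_def using Suc.prems c s by (intro Suc.IH) (auto intro!: add_pos_nonneg)
  also have "\<dots> \<le> ennreal (1 / sqrt (2 * pi * (v + w\<^sup>2 * (real (Suc j) * h) * (P * c)\<^sup>2)))
        * (\<integral>\<^sup>+\<omega>. ennreal (Z \<omega>) \<partial>M)"
  proof (intro mult_right_mono ennreal_leI)
    \<comment> \<open>The newest increment has not been contracted at all; shrinking its variance by
      \<open>(P * c)\<^sup>2\<close> gives all increments a common factor and hence a closed
      form.\<close>
    have Pc: "(P * c)\<^sup>2 \<le> 1"
      using P c by (simp add: mult_le_one power_le_one)
    have "w\<^sup>2 * h * (P * c)\<^sup>2 \<le> w\<^sup>2 * h * 1"
      using s Pc by (intro mult_left_mono) auto
    then have "v + w\<^sup>2 * (real (Suc j) * h) * (P * c)\<^sup>2 \<le> v + w\<^sup>2 * h + (w * c)\<^sup>2 * (real j * h) * P\<^sup>2"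
      by (simp add: algebra_simps power_mult_distrib)
    moreover have "0 < v + w\<^sup>2 * (real (Suc j) * h) * (P * c)\<^sup>2"
      using Suc.prems s by (intro add_pos_nonneg) auto
    ultimately show "1 / sqrt (2 * pi * (v + w\<^sup>2 * h + (w * c)\<^sup>2 * (real j * h) * P\<^sup>2))
      \<le> 1 / sqrt (2 * pi * (v + w\<^sup>2 * (real (Suc j) * h) * (P * c)\<^sup>2))"
      by (intro divide_left_mono real_sqrt_le_mono mult_left_mono mult_pos_pos real_sqrt_gt_zero) auto
  qed simp
  finally show ?case
    by (simp add: P_def c_def)
qed

text \<open>While \<open>A * (r - s)\<close> is at most 1/2, the product of contractions is at least
  1/2, so the scheme keeps a variance of at least \<open>(r - s) / 4\<close>; as
  \<open>2 * pi / 4 \<ge> 1\<close>, the constant is 1. The bound is uniform in \<open>N\<close> and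
  survives the limit by Fatou's lemma.\<close>

lemma density_bound_short:
  assumes s: "0 \<le> s" "s < r" and A: "\<And>u. 0 \<le> u \<Longrightarrow> u \<le> r \<Longrightarrow> \<alpha> u \<le> A"
    and short: "A * (r - s) \<le> 1 / 2"
    and Z: "Z \<in> borel_measurable (F s)" "\<And>\<omega>. 0 \<le> Z \<omega>"
    and v: "0 < v"
  shows "(\<integral>\<^sup>+\<omega>. ennreal (Z \<omega> * heat_kernel v (X r \<omega> - x)) \<partial>M)
    \<le> ennreal (1 / sqrt (r - s)) * (\<integral>\<^sup>+\<omega>. ennreal (Z \<omega>) \<partial>M)"
proof -
  define h where "h N = (r - s) / real N" for N
  define E where "E N \<omega> = euler \<alpha> (\<lambda>t. W t \<omega>) (X s \<omega>) s (h N) N" for N \<omega>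
  have A0: "0 \<le> A" using A[of 0] \<alpha>_nonneg[of 0] s by auto
  have Z_meas [measurable]: "Z \<in> borel_measurable M" using measurable_F_M[OF Z(1) s(1)] .
  have E_meas [measurable]: "E N \<in> borel_measurable M" for N
    unfolding E_def[abs_def]
    by (rule measurable_F_M[OF euler_adapted]) (use s in \<open>auto simp: h_def\<close>)
  have lim: "AE \<omega> in M. (\<lambda>N. ennreal (Z \<omega> * heat_kernel v (E N \<omega> - x)))
      \<longlonglongrightarrow> ennreal (Z \<omega> * heat_kernel v (X r \<omega> - x))"
    using X_eq
  proof eventually_elim
    case (elim \<omega>)
    have "(\<lambda>N. E N \<omega>) \<longlonglongrightarrow> X r \<omega>"
      unfolding E_def h_def using elim s A \<alpha>_nonneg \<alpha>_integrable[of r]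
      by (intro euler_tendsto[where A=A and f="\<lambda>t. X t \<omega>"])
         (auto intro: continuous_on_subset[OF X_continuous])
    moreover have "isCont (\<lambda>y. heat_kernel v (y - x)) (X r \<omega>)"
    proof -
      have "continuous_on UNIV (\<lambda>y. heat_kernel v (y - x))"
        by (intro continuous_intros)
      then show ?thesis by (simp add: continuous_on_eq_continuous_at)
    qed
    ultimately have "(\<lambda>N. heat_kernel v (E N \<omega> - x)) \<longlonglongrightarrow> heat_kernel v (X r \<omega> - x)"
      by (rule isCont_tendsto_compose[rotated])
    then show ?case by (intro tendsto_ennrealI tendsto_mult tendsto_const)
  qed
  have bound: "(\<integral>\<^sup>+\<omega>. ennreal (Z \<omega> * heat_kernel v (E N \<omega> - x)) \<partial>M)
      \<le> ennreal (1 / sqrt (r - s)) * (\<integral>\<^sup>+\<omega>. ennreal (Z \<omega>) \<partial>M)" if N: "0 < N" for N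
  proof -
    have h: "0 < h N" "real N * h N = r - s" using N s by (auto simp: h_def)
    have dr: "0 \<le> drift s (h N) i \<and> drift s (h N) i \<le> A * h N" if "i < N" for i
    proof -
      define a b where "a = s + real i * h N" and "b = s + real (Suc i) * h N"
      have "real (Suc i) * h N \<le> real N * h N" using that h(1) by (intro mult_right_mono) auto
      then have ab: "0 \<le> a" "a \<le> b" "b \<le> r" "b - a = h N"
        using h s unfolding a_def b_def by (auto simp: algebra_simps)
      have "0 \<le> drift s (h N) i"
        unfolding drift_def set_lebesgue_integral_def using \<alpha>_nonneg ab
        by (intro Bochner_Integration.integral_nonneg) (auto simp: indicator_def a_def b_def)
      moreover have "\<bar>LINT u:{a<..b}|lborel. \<alpha> u\<bar> \<le> A * (b - a)"
      proof (rule set_integral_Ioc_bound)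
        show "set_integrable lborel {a<..b} \<alpha>"
          by (rule set_integrable_subset[OF \<alpha>_integrable[of r]]) (use ab s in auto)
        show "\<bar>\<alpha> u\<bar> \<le> A" if "u \<in> {a<..b}" for u
          using that ab A[of u] \<alpha>_nonneg[of u] by simp
      qed (rule ab(2))
      ultimately show ?thesis using ab unfolding drift_def a_def b_def by auto
    qed
    have "A * h N \<le> A * (r - s)"
      using A0 N h mult_right_mono[of 1 "real N" "h N"] by (intro mult_left_mono) auto
    then have Ah: "A * h N \<le> 1 / 2" using short by simp
    define P where "P = (\<Prod>i<N. 1 - drift s (h N) i)"
    have "1 - (\<Sum>i<N. drift s (h N) i) \<le> P"
      unfolding P_def
    proof (rule prod_one_minus_ge)
      show "0 \<le> drift s (h N) i \<and> drift s (h N) i \<le> 1" if "i < N" for i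
        using dr[OF that] Ah by auto
    qed
    moreover have "(\<Sum>i<N. drift s (h N) i) \<le> (\<Sum>i<N. A * h N)"
      using dr by (intro sum_mono) auto
    moreover have "(\<Sum>i<N. A * h N) = A * (r - s)" using h(2) by (simp add: mult_ac)
    ultimately have "1 / 2 \<le> P" using short by linarith
    then have P: "1 / 4 \<le> P\<^sup>2"
      using power_mono[of "1/2" P 2] by (simp add: power2_eq_square)
    have "(\<integral>\<^sup>+\<omega>. ennreal (Z \<omega> * heat_kernel v (E N \<omega> - x)) \<partial>M)
      = (\<integral>\<^sup>+\<omega>. ennreal (Z \<omega> * heat_kernel v (1 * euler \<alpha> (\<lambda>t. W t \<omega>) (X s \<omega>) s (h N) N - x)) \<partial>M)"
      by (simp add: E_def)
    also have "\<dots> \<le> ennreal (1 / sqrt (2 * pi * (v + 1\<^sup>2 * (real N * h N) * P\<^sup>2))) * (\<integral>\<^sup>+\<omega>. ennreal (Z \<omega>) \<partial>M)"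
      unfolding P_def
    proof (rule euler_density_bound)
      show "0 \<le> drift s (h N) i \<and> drift s (h N) i < 1" if "i < N" for i
        using dr[OF that] Ah by auto
    qed (use s h Z v in auto)
    also have "\<dots> \<le> ennreal (1 / sqrt (r - s)) * (\<integral>\<^sup>+\<omega>. ennreal (Z \<omega>) \<partial>M)"
    proof (intro mult_right_mono ennreal_leI)
      have "r - s \<le> 2 * pi * ((r - s) * (1 / 4))"
        using pi_gt3 s mult_right_mono[of 2 pi "r - s"] by simp
      also have "\<dots> \<le> 2 * pi * (v + 1\<^sup>2 * (real N * h N) * P\<^sup>2)"
      proof (rule mult_left_mono)
        have "(r - s) * (1 / 4) \<le> (r - s) * P\<^sup>2" using s by (intro mult_left_mono P) simp
        then show "(r - s) * (1 / 4) \<le> v + 1\<^sup>2 * (real N * h N) * P\<^sup>2"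
          unfolding h(2) power_one mult_1 using v by linarith
      qed simp
      finally show "1 / sqrt (2 * pi * (v + 1\<^sup>2 * (real N * h N) * P\<^sup>2)) \<le> 1 / sqrt (r - s)"
        using s by (intro divide_left_mono real_sqrt_le_mono mult_pos_pos) auto
    qed simp
    finally show ?thesis .
  qed
  have "(\<integral>\<^sup>+\<omega>. ennreal (Z \<omega> * heat_kernel v (X r \<omega> - x)) \<partial>M)
    = (\<integral>\<^sup>+\<omega>. liminf (\<lambda>N. ennreal (Z \<omega> * heat_kernel v (E N \<omega> - x))) \<partial>M)"
    using lim by (intro nn_integral_cong_AE) (auto simp: lim_imp_Liminf)
  also have "\<dots> \<le> liminf (\<lambda>N. \<integral>\<^sup>+\<omega>. ennreal (Z \<omega> * heat_kernel v (E N \<omega> - x)) \<partial>M)"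
    by (rule nn_integral_liminf) measurable
  also have "\<dots> \<le> ennreal (1 / sqrt (r - s)) * (\<integral>\<^sup>+\<omega>. ennreal (Z \<omega>) \<partial>M)"
    by (intro Liminf_le eventually_mono[OF eventually_gt_at_top[of 0]] bound) simp_all
  finally show ?thesis .
qed

text \<open>On a long interval only the last stretch of length \<open>1 / (2 * A)\<close> matters:
  \<open>Z\<close> is also measurable at its left end \<open>s'\<close>, from where the short bound
  gives exactly \<open>sqrt (2 * A)\<close>.\<close>

lemma density_bound:
  assumes s: "0 \<le> s" "s < r" and A: "\<And>u. 0 \<le> u \<Longrightarrow> u \<le> r \<Longrightarrow> \<alpha> u \<le> A" and A0: "0 < A"
    and Z: "Z \<in> borel_measurable (F s)" "\<And>\<omega>. 0 \<le> Z \<omega>"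
    and v: "0 < v"
  shows "(\<integral>\<^sup>+\<omega>. ennreal (Z \<omega> * heat_kernel v (X r \<omega> - x)) \<partial>M)
    \<le> ennreal (1 / sqrt (r - s) + sqrt (2 * A)) * (\<integral>\<^sup>+\<omega>. ennreal (Z \<omega>) \<partial>M)"
proof (cases "A * (r - s) \<le> 1 / 2")
  case True
  have "(\<integral>\<^sup>+\<omega>. ennreal (Z \<omega> * heat_kernel v (X r \<omega> - x)) \<partial>M)
    \<le> ennreal (1 / sqrt (r - s)) * (\<integral>\<^sup>+\<omega>. ennreal (Z \<omega>) \<partial>M)"
    by (rule density_bound_short[OF s A True Z v])
  also have "\<dots> \<le> ennreal (1 / sqrt (r - s) + sqrt (2 * A)) * (\<integral>\<^sup>+\<omega>. ennreal (Z \<omega>) \<partial>M)"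
    using A0 by (intro mult_right_mono ennreal_leI) auto
  finally show ?thesis .
next
  case False
  define s' where "s' = r - 1 / (2 * A)"
  have "1 / (2 * A) < r - s" "0 < 1 / (2 * A)"
    using False A0 by (auto simp: field_simps)
  then have s': "s \<le> s'" "0 \<le> s'" "s' < r" "r - s' = 1 / (2 * A)"
    using s unfolding s'_def by linarith+
  have "(\<integral>\<^sup>+\<omega>. ennreal (Z \<omega> * heat_kernel v (X r \<omega> - x)) \<partial>M)
    \<le> ennreal (1 / sqrt (r - s')) * (\<integral>\<^sup>+\<omega>. ennreal (Z \<omega>) \<partial>M)"
    using s' A0 A measurable_F_mono[OF Z(1) s(1) s'(1)] Z(2) v
    by (intro density_bound_short[where A=A]) auto
  also have "\<dots> \<le> ennreal (1 / sqrt (r - s) + sqrt (2 * A)) * (\<integral>\<^sup>+\<omega>. ennreal (Z \<omega>) \<partial>M)"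
    using s'(4) s by (intro mult_right_mono ennreal_leI) (auto simp: real_sqrt_divide)
  finally show ?thesis .
qed

end

section \<open>Tail integrals and Laplace transforms\<close>

lemma floor_over_tendsto: "(\<lambda>n. real_of_int \<lfloor>real (Suc n) * t\<rfloor> / real (Suc n)) \<longlonglongrightarrow> t"
proof (rule tendsto_sandwich)
  have "t - 1 / real (Suc n) \<le> real_of_int \<lfloor>real (Suc n) * t\<rfloor> / real (Suc n)" for n
  proof -
    have "real (Suc n) * t - 1 \<le> real_of_int \<lfloor>real (Suc n) * t\<rfloor>" by linarith
    then have "(real (Suc n) * t - 1) / real (Suc n) \<le> real_of_int \<lfloor>real (Suc n) * t\<rfloor> / real (Suc n)"
      by (rule divide_right_mono) simp
    then show ?thesis by (simp add: diff_divide_distrib del: of_nat_Suc)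
  qed
  then show "\<forall>\<^sub>F n in sequentially. t - 1 / real (Suc n) \<le> real_of_int \<lfloor>real (Suc n) * t\<rfloor> / real (Suc n)"
    by simp
  have "real_of_int \<lfloor>real (Suc n) * t\<rfloor> / real (Suc n) \<le> t" for n
  proof -
    have "real_of_int \<lfloor>real (Suc n) * t\<rfloor> / real (Suc n) \<le> (real (Suc n) * t) / real (Suc n)"
      by (intro divide_right_mono) simp_all
    then show ?thesis by (simp del: of_nat_Suc)
  qed
  then show "\<forall>\<^sub>F n in sequentially. real_of_int \<lfloor>real (Suc n) * t\<rfloor> / real (Suc n) \<le> t"
    by simp
  have "(\<lambda>n. t - 1 / real (Suc n)) \<longlonglongrightarrow> t - 0"
    by (intro tendsto_intros LIMSEQ_Suc[OF lim_const_over_n])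
  then show "(\<lambda>n. t - 1 / real (Suc n)) \<longlonglongrightarrow> t" by simp
qed simp

text \<open>Rounding the time down to a grid leaves countably many measurable pieces, and continuity
  makes these step processes converge at every point.\<close>

lemma borel_measurable_continuous_process:
  fixes Y :: "real \<Rightarrow> 'a \<Rightarrow> real"
  assumes Y: "\<And>t. Y t \<in> borel_measurable M" and cont: "\<And>\<omega>. continuous_on UNIV (\<lambda>t. Y t \<omega>)"
  shows "(\<lambda>p. Y (snd p) (fst p)) \<in> borel_measurable (M \<Otimes>\<^sub>M lborel)"
proof (rule borel_measurable_LIMSEQ_metric)
  fix n
  show "(\<lambda>p. Y (real_of_int \<lfloor>real (Suc n) * snd p\<rfloor> / real (Suc n)) (fst p)) \<in> borel_measurable (M \<Otimes>\<^sub>M lborel)"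
    by (rule measurable_compose_countable[where f="\<lambda>i p. Y (real_of_int i / real (Suc n)) (fst p)"])
       (auto intro!: measurable_compose[OF measurable_fst Y])
next
  fix p
  have "isCont (\<lambda>t. Y t (fst p)) (snd p)"
    using cont[of "fst p"] by (simp add: continuous_on_eq_continuous_at)
  from isCont_tendsto_compose[OF this floor_over_tendsto]
  show "(\<lambda>n. Y (real_of_int \<lfloor>real (Suc n) * snd p\<rfloor> / real (Suc n)) (fst p)) \<longlonglongrightarrow> Y (snd p) (fst p)" .
qed

lemma set_integral_Icc_eq_integral:
  fixes \<phi> :: "real \<Rightarrow> real"
  assumes "continuous_on UNIV \<phi>"
  shows "(LINT u:{a..b}|lborel. \<phi> u) = integral {a..b} \<phi>"
  by (intro set_borel_integral_eq_integral borel_integrable_atLeastAtMost')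
     (rule continuous_on_subset[OF assms], simp)

text \<open>Fundamental theorem of calculus for minus the power \<open>Suc n\<close> of the tail
  integral. Seen as an integral over \<open>Suc n\<close> visit times, it isolates the first of
  them; the factor \<open>Suc n\<close> counts which one comes first.\<close>

lemma nn_integral_power_tail:
  fixes \<phi> :: "real \<Rightarrow> real"
  assumes cont: "continuous_on UNIV \<phi>" and nonneg: "\<And>r. 0 \<le> \<phi> r" and st: "s \<le> t"
  shows "(\<integral>\<^sup>+r. ennreal (real (Suc n) * \<phi> r * (LINT u:{r..t}|lborel. \<phi> u) ^ n) * indicator {s<..t} r \<partial>lborel)
    = ennreal ((LINT u:{s..t}|lborel. \<phi> u) ^ Suc n)"
proof -
  \<comment> \<open>Starting at \<open>s - 1\<close> makes \<open>s\<close> an interior point, so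
    that the derivative is two-sided on all of \<open>{s..t}\<close>.\<close>
  define K where "K r = integral {s - 1..r} \<phi>" for r
  have int: "\<phi> integrable_on {a..b}" for a b
    by (intro integrable_continuous_real continuous_on_subset[OF cont]) simp
  have tail: "(LINT u:{r..t}|lborel. \<phi> u) = K t - K r" if "r \<in> {s..t}" for r
    using Henstock_Kurzweil_Integration.integral_combine[OF _ _ int, of "s - 1" r t] that
    by (simp add: set_integral_Icc_eq_integral[OF cont] K_def)
  have mono: "K r \<le> K t" if "r \<in> {s..t}" for r
    unfolding K_def using that nonneg by (intro integral_subset_le int) auto
  have DK: "(K has_real_derivative \<phi> r) (at r)" if "r \<in> {s..t}" for r
  proof -
    have "(K has_real_derivative \<phi> r) (at r within {s - 1..t + 1})"
      unfolding K_def using that by (intro integral_has_real_derivative continuous_on_subset[OF cont]) auto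
    moreover have "at r within {s - 1..t + 1} = at r"
      using that by (intro at_within_interior) auto
    ultimately show ?thesis by simp
  qed
  define f where "f r = indicator {s..t} r *\<^sub>R (real (Suc n) * \<phi> r * (K t - K r) ^ n)" for r
  have K_cont: "continuous_on {s..t} K"
    by (intro continuous_at_imp_continuous_on ballI DERIV_isCont[OF DK])
  have f_meas: "f \<in> borel_measurable borel"
    unfolding f_def[abs_def]
    by (intro borel_measurable_continuous_on_indicator)
       (auto intro!: continuous_intros K_cont continuous_on_subset[OF cont])
  have "(\<integral>\<^sup>+r. ennreal (real (Suc n) * \<phi> r * (LINT u:{r..t}|lborel. \<phi> u) ^ n) * indicator {s<..t} r \<partial>lborel)
    = (\<integral>\<^sup>+r. ennreal (f r) * indicator {s..t} r \<partial>lborel)"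
  proof (rule nn_integral_cong_AE)
    show "AE r in lborel. ennreal (real (Suc n) * \<phi> r * (LINT u:{r..t}|lborel. \<phi> u) ^ n) * indicator {s<..t} r
        = ennreal (f r) * indicator {s..t} r"
      \<comment> \<open>The left end is missing from the statement because the density bound needs
        \<open>s < r\<close>; as a null set it may be restored here.\<close>
      using AE_lborel_singleton[of s]
      by eventually_elim (auto simp: f_def tail indicator_def)
  qed
  also have "\<dots> = (- ((K t - K t) ^ Suc n)) - (- ((K t - K s) ^ Suc n))"
  proof (rule nn_integral_FTC_Icc[OF f_meas])
    fix r assume r: "r \<in> {s..t}"
    have "((\<lambda>r. - ((K t - K r) ^ Suc n)) has_real_derivative real (Suc n) * \<phi> r * (K t - K r) ^ n) (at r)"
      by (auto intro!: derivative_eq_intros DK[OF r] simp del: power_Suc simp: algebra_simps)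
    then show "((\<lambda>r. - ((K t - K r) ^ Suc n)) has_real_derivative f r) (at r)"
      using r by (simp add: f_def)
    show "0 \<le> f r" using r nonneg mono[OF r] by (auto simp: f_def)
  qed (use st in auto)
  also have "\<dots> = ennreal ((LINT u:{s..t}|lborel. \<phi> u) ^ Suc n)"
    using st by (simp add: tail)
  finally show ?thesis .
qed

text \<open>The substitution \<open>u = \<Lambda> * (r - s)\<close> leads to
  \<open>Gamma (1 / 2) = sqrt pi\<close> and \<open>Gamma 1 = 1\<close>. After
  \<open>sqrt (2 * A) \<le> sqrt (2 * \<Lambda>)\<close> both terms scale like
  \<open>1 / sqrt \<Lambda>\<close>, and \<open>sqrt pi + sqrt 2 \<le> 4\<close>.\<close>

lemma nn_integral_Laplace_bound:
  fixes \<Lambda> A :: real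
  assumes "0 < A" "A \<le> \<Lambda>"
  shows "(\<integral>\<^sup>+r. ennreal (exp (- (\<Lambda> * (r - s))) * (1 / sqrt (r - s) + sqrt (2 * A))) * indicator {s<..t} r \<partial>lborel)
    \<le> ennreal (4 / sqrt \<Lambda>)"
proof -
  have L: "0 < \<Lambda>" using assms by simp
  define g where "g a u = ennreal (indicator {0..} u * u powr (a - 1) / exp u)" for a u :: real
  define f where "f u = g (1 / 2) u + ennreal (sqrt 2) * g 1 u" for u
  have [measurable]: "g a \<in> borel_measurable borel" for a unfolding g_def by measurable
  have [measurable]: "f \<in> borel_measurable borel" unfolding f_def by measurable
  have g_int: "0 < a \<Longrightarrow> (\<integral>\<^sup>+u. g a u \<partial>lborel) = ennreal (Gamma a)" for a
    unfolding g_def using Gamma_conv_nn_integral_real[of a] by simp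
  have "(\<integral>\<^sup>+u. f u \<partial>lborel) = ennreal (sqrt pi) + ennreal (sqrt 2)"
    unfolding f_def by (simp add: nn_integral_add nn_integral_cmult g_int Gamma_one_half_real)
  also have "\<dots> = ennreal (sqrt pi + sqrt 2)" by (rule ennreal_plus[symmetric]) auto
  also have "\<dots> \<le> ennreal 4"
  proof (rule ennreal_leI)
    have "sqrt pi \<le> 2" "sqrt 2 \<le> (2::real)"
      using pi_less_4 by (auto intro!: real_le_lsqrt)
    then show "sqrt pi + sqrt 2 \<le> 4" by linarith
  qed
  finally have f_int: "(\<integral>\<^sup>+u. f u \<partial>lborel) \<le> ennreal 4" .
  have pointwise: "ennreal (exp (- (\<Lambda> * (r - s))) * (1 / sqrt (r - s) + sqrt (2 * A))) * indicator {s<..t} r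
      \<le> ennreal (sqrt \<Lambda>) * f (- \<Lambda> * s + \<Lambda> * r)" for r
  proof (cases "r \<in> {s<..t}")
    case True
    define u where "u = r - s"
    have u: "0 < u" using True by (simp add: u_def)
    have arg: "- \<Lambda> * s + \<Lambda> * r = \<Lambda> * u" by (simp add: u_def algebra_simps)
    have "f (\<Lambda> * u) = ennreal (1 / sqrt (\<Lambda> * u) / exp (\<Lambda> * u)) + ennreal (sqrt 2) * ennreal (1 / exp (\<Lambda> * u))"
      using L u by (simp add: f_def g_def powr_minus_divide powr_half_sqrt)
    also have "\<dots> = ennreal (1 / sqrt (\<Lambda> * u) / exp (\<Lambda> * u) + sqrt 2 * (1 / exp (\<Lambda> * u)))"
      using L u by (subst ennreal_plus) (auto simp: ennreal_mult[symmetric])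
    finally have "ennreal (sqrt \<Lambda>) * f (\<Lambda> * u)
      = ennreal (sqrt \<Lambda> * (1 / sqrt (\<Lambda> * u) / exp (\<Lambda> * u) + sqrt 2 * (1 / exp (\<Lambda> * u))))"
      using L u by (simp add: ennreal_mult)
    also have "sqrt \<Lambda> * (1 / sqrt (\<Lambda> * u) / exp (\<Lambda> * u) + sqrt 2 * (1 / exp (\<Lambda> * u)))
      = exp (- (\<Lambda> * u)) * (1 / sqrt u + sqrt (2 * \<Lambda>))"
      using L u by (simp add: real_sqrt_mult exp_minus field_simps)
    also have "ennreal (exp (- (\<Lambda> * u)) * (1 / sqrt u + sqrt (2 * A))) \<le> ennreal \<dots>"
      using assms by (intro ennreal_leI mult_left_mono add_left_mono) auto
    finally show ?thesis
      unfolding arg using True by (simp add: u_def)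
  qed simp
  have "(\<integral>\<^sup>+r. ennreal (exp (- (\<Lambda> * (r - s))) * (1 / sqrt (r - s) + sqrt (2 * A))) * indicator {s<..t} r \<partial>lborel)
    \<le> (\<integral>\<^sup>+r. ennreal (sqrt \<Lambda>) * f (- \<Lambda> * s + \<Lambda> * r) \<partial>lborel)"
    by (intro nn_integral_mono pointwise)
  also have "\<dots> = ennreal (sqrt \<Lambda>) * (\<integral>\<^sup>+r. f (- \<Lambda> * s + \<Lambda> * r) \<partial>lborel)"
    by (rule nn_integral_cmult) measurable
  \<comment> \<open>The factor \<Lambda> split off here is the Jacobian of the substitution.\<close>
  also have "\<dots> = ennreal (1 / sqrt \<Lambda>) * (ennreal \<Lambda> * (\<integral>\<^sup>+r. f (- \<Lambda> * s + \<Lambda> * r) \<partial>lborel))"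
  proof -
    have "sqrt \<Lambda> = 1 / sqrt \<Lambda> * \<Lambda>" using L by (simp add: real_div_sqrt)
    then have "ennreal (sqrt \<Lambda>) = ennreal (1 / sqrt \<Lambda>) * ennreal \<Lambda>"
      using L by (metis ennreal_mult less_imp_le real_sqrt_ge_zero zero_le_divide_1_iff)
    then show ?thesis by (simp add: mult.assoc)
  qed
  also have "ennreal \<Lambda> * (\<integral>\<^sup>+r. f (- \<Lambda> * s + \<Lambda> * r) \<partial>lborel) = (\<integral>\<^sup>+u. f u \<partial>lborel)"
    using nn_integral_real_affine[of f \<Lambda> "- \<Lambda> * s"] L by simp
  also have "ennreal (1 / sqrt \<Lambda>) * \<dots> \<le> ennreal (1 / sqrt \<Lambda>) * ennreal 4"
    by (intro mult_left_mono f_int) simp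
  also have "\<dots> = ennreal (4 / sqrt \<Lambda>)"
    using L by (subst ennreal_mult[symmetric]) auto
  finally show ?thesis .
qed

section \<open>Moments of occupation integrals\<close>

context linear_drift_diffusion
begin

definition occupation :: "real \<Rightarrow> real \<Rightarrow> real \<Rightarrow> real \<Rightarrow> 'a \<Rightarrow> real" where
  "occupation \<epsilon> x s t \<omega> = (LINT r:{s..t}|lborel. heat_kernel \<epsilon> (X r \<omega> - x))"

lemma heat_kernel_X_continuous: "continuous_on UNIV (\<lambda>r. heat_kernel \<epsilon> (X r \<omega> - x))"
  by (intro continuous_intros X_continuous)

lemma X_jointly_measurable [measurable]: "(\<lambda>p. X (snd p) (fst p)) \<in> borel_measurable (M \<Otimes>\<^sub>M lborel)"
  by (rule borel_measurable_continuous_process[OF X_measurable X_continuous])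

text \<open>The lower limit is a variable because it becomes the integration variable once the first
  visit time is split off; exchanging the integrals then needs joint measurability.\<close>

lemma occupation_jointly_measurable:
  "(\<lambda>p. occupation \<epsilon> x (snd p) t (fst p)) \<in> borel_measurable (M \<Otimes>\<^sub>M lborel)"
proof -
  have proj: "(\<lambda>q. (fst (fst q), snd q)) \<in> (M \<Otimes>\<^sub>M lborel) \<Otimes>\<^sub>M lborel \<rightarrow>\<^sub>M M \<Otimes>\<^sub>M lborel"
    by measurable
  have [measurable]: "(\<lambda>q. X (snd q) (fst (fst q))) \<in> borel_measurable ((M \<Otimes>\<^sub>M lborel) \<Otimes>\<^sub>M lborel)"
    using measurable_compose[OF proj X_jointly_measurable] unfolding fst_conv snd_conv by blast
  have "(\<lambda>q. indicator {u. snd (fst q) \<le> u \<and> u \<le> t} (snd q) *\<^sub>R heat_kernel \<epsilon> (X (snd q) (fst (fst q)) - x))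
     \<in> borel_measurable ((M \<Otimes>\<^sub>M lborel) \<Otimes>\<^sub>M lborel)"
    unfolding indicator_def by measurable
  then have "(\<lambda>p. \<integral>u. indicator {u. snd p \<le> u \<and> u \<le> t} u *\<^sub>R heat_kernel \<epsilon> (X u (fst p) - x) \<partial>lborel)
     \<in> borel_measurable (M \<Otimes>\<^sub>M lborel)"
    by (intro lborel.borel_measurable_lebesgue_integral) (simp add: case_prod_beta')
  then show ?thesis
    by (simp add: occupation_def set_lebesgue_integral_def atLeastAtMost_def atLeast_def atMost_def Int_def)
qed

lemma occupation_measurable [measurable]: "occupation \<epsilon> x s t \<in> borel_measurable M"
  using measurable_compose[OF _ occupation_jointly_measurable, of "\<lambda>\<omega>. (\<omega>, s)" M \<epsilon> x t] by simp

lemma occupation_nonneg: "0 < \<epsilon> \<Longrightarrow> 0 \<le> occupation \<epsilon> x s t \<omega>"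
  unfolding occupation_def set_lebesgue_integral_def
  by (intro Bochner_Integration.integral_nonneg) (simp add: heat_kernel_nonneg)

lemma occupation_add:
  assumes "s \<le> r" "r \<le> t"
  shows "occupation \<epsilon> x s t \<omega> = occupation \<epsilon> x s r \<omega> + occupation \<epsilon> x r t \<omega>"
  unfolding occupation_def set_integral_Icc_eq_integral[OF heat_kernel_X_continuous]
  by (intro Henstock_Kurzweil_Integration.integral_combine[symmetric] assms
      integrable_continuous_real continuous_on_subset[OF heat_kernel_X_continuous]) simp

text \<open>Khasminskii's lemma: the first visit time \<open>r\<close> is split off, and the density bound is applied
  conditionally on the time \<open>s\<close>. The exponential weight turns the resulting iterated convolution
  of \<open>1 / sqrt\<close> into a power of its Laplace transform.\<close>

lemma occupation_moment_bound:
  assumes A: "\<And>u. 0 \<le> u \<Longrightarrow> u \<le> t \<Longrightarrow> \<alpha> u \<le> A" "0 < A" "A \<le> \<Lambda>" and \<epsilon>: "0 < \<epsilon>"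
    and s: "0 \<le> s" "s \<le> t" and Z: "Z \<in> borel_measurable (F s)" "\<And>\<omega>. 0 \<le> Z \<omega>"
  shows "(\<integral>\<^sup>+\<omega>. ennreal (Z \<omega> * occupation \<epsilon> x s t \<omega> ^ n) \<partial>M)
    \<le> ennreal (fact n * (4 / sqrt \<Lambda>) ^ n * exp (\<Lambda> * (t - s))) * (\<integral>\<^sup>+\<omega>. ennreal (Z \<omega>) \<partial>M)"
  using s Z
\<comment> \<open>The induction hypothesis is used at the visit time \<open>r\<close> with the
  weight \<open>Suc n * (Z * \<phi> r)\<close>, which is \<open>F r\<close>-measurable; hence both
  \<open>s\<close> and \<open>Z\<close> must vary.\<close>
proof (induction n arbitrary: s Z)
  case 0
  have "1 * (\<integral>\<^sup>+\<omega>. ennreal (Z \<omega>) \<partial>M) \<le> ennreal (exp (\<Lambda> * (t - s))) * (\<integral>\<^sup>+\<omega>. ennreal (Z \<omega>) \<partial>M)"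
    using 0 A by (intro mult_right_mono) (auto simp: ennreal_1[symmetric] simp del: ennreal_1 intro!: ennreal_leI)
  then show ?case by simp
next
  case (Suc n)
  define \<phi> where "\<phi> r \<omega> = heat_kernel \<epsilon> (X r \<omega> - x)" for r \<omega>
  define c where "c = fact (Suc n) * (4 / sqrt \<Lambda>) ^ n * exp (\<Lambda> * (t - s))"
  let ?I = "\<integral>\<^sup>+\<omega>. ennreal (Z \<omega>) \<partial>M"
  have L: "0 < \<Lambda>" using A by simp
  have c: "0 \<le> c" using L by (simp add: c_def)
  have \<phi>_nonneg: "0 \<le> \<phi> r \<omega>" for r \<omega> using \<epsilon> by (simp add: \<phi>_def heat_kernel_nonneg)
  have Z_meas [measurable]: "Z \<in> borel_measurable M" using measurable_F_M[OF Suc.prems(3,1)] .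
  interpret MM: pair_sigma_finite M lborel ..
  have joint [measurable]: "(\<lambda>p. ennreal (Z (fst p) * (real (Suc n) * \<phi> (snd p) (fst p) * occupation \<epsilon> x (snd p) t (fst p) ^ n))
      * indicator {s<..t} (snd p)) \<in> borel_measurable (M \<Otimes>\<^sub>M lborel)"
    using occupation_jointly_measurable[of \<epsilon> x t] unfolding \<phi>_def by measurable
  have "(\<integral>\<^sup>+\<omega>. ennreal (Z \<omega> * occupation \<epsilon> x s t \<omega> ^ Suc n) \<partial>M)
    = (\<integral>\<^sup>+\<omega>. \<integral>\<^sup>+r. ennreal (Z \<omega> * (real (Suc n) * \<phi> r \<omega> * occupation \<epsilon> x r t \<omega> ^ n)) * indicator {s<..t} r \<partial>lborel \<partial>M)"
  proof (rule nn_integral_cong)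
    fix \<omega> assume \<omega>: "\<omega> \<in> space M"
    have [measurable]: "(\<lambda>r. ennreal (real (Suc n) * \<phi> r \<omega> * occupation \<epsilon> x r t \<omega> ^ n) * indicator {s<..t} r) \<in> borel_measurable lborel"
    proof -
      have [measurable]: "(\<lambda>r. X r \<omega>) \<in> borel_measurable borel"
        by (rule borel_measurable_continuous_onI[OF X_continuous])
      have "(\<lambda>r. occupation \<epsilon> x r t \<omega>) \<in> borel_measurable lborel"
        using measurable_compose[OF _ occupation_jointly_measurable, of "\<lambda>r. (\<omega>, r)" lborel \<epsilon> x t] \<omega> by simp
      then show ?thesis unfolding \<phi>_def by measurable
    qed
    have "ennreal (Z \<omega> * occupation \<epsilon> x s t \<omega> ^ Suc n) = ennreal (Z \<omega>) * ennreal (occupation \<epsilon> x s t \<omega> ^ Suc n)"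
      by (rule ennreal_mult) (use Suc.prems occupation_nonneg[OF \<epsilon>] in auto)
    also have "\<dots> = ennreal (Z \<omega>) *
        (\<integral>\<^sup>+r. ennreal (real (Suc n) * \<phi> r \<omega> * occupation \<epsilon> x r t \<omega> ^ n) * indicator {s<..t} r \<partial>lborel)"
      unfolding occupation_def \<phi>_def
      using nn_integral_power_tail[OF heat_kernel_X_continuous[of \<epsilon> \<omega> x] _ Suc.prems(2), of n] heat_kernel_nonneg \<epsilon>
      by simp
    also have "\<dots> = (\<integral>\<^sup>+r. ennreal (Z \<omega>) * (ennreal (real (Suc n) * \<phi> r \<omega> * occupation \<epsilon> x r t \<omega> ^ n) * indicator {s<..t} r) \<partial>lborel)"
      by (rule nn_integral_cmult[symmetric]) measurable
    also have "\<dots> = (\<integral>\<^sup>+r. ennreal (Z \<omega> * (real (Suc n) * \<phi> r \<omega> * occupation \<epsilon> x r t \<omega> ^ n)) * indicator {s<..t} r \<partial>lborel)"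
      using Suc.prems(4) by (simp add: ennreal_mult' mult.assoc del: of_nat_Suc)
    finally show "ennreal (Z \<omega> * occupation \<epsilon> x s t \<omega> ^ Suc n) = \<dots>" .
  qed
  also have "\<dots> = (\<integral>\<^sup>+r. \<integral>\<^sup>+\<omega>. ennreal (Z \<omega> * (real (Suc n) * \<phi> r \<omega> * occupation \<epsilon> x r t \<omega> ^ n)) * indicator {s<..t} r \<partial>M \<partial>lborel)"
    by (rule MM.Fubini'[symmetric]) (use joint in \<open>simp add: case_prod_beta'\<close>)
  also have "\<dots> \<le> (\<integral>\<^sup>+r. ennreal c * ?I * (ennreal (exp (- (\<Lambda> * (r - s))) * (1 / sqrt (r - s) + sqrt (2 * A))) * indicator {s<..t} r) \<partial>lborel)"
  proof (rule nn_integral_mono)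
    fix r
    show "(\<integral>\<^sup>+\<omega>. ennreal (Z \<omega> * (real (Suc n) * \<phi> r \<omega> * occupation \<epsilon> x r t \<omega> ^ n)) * indicator {s<..t} r \<partial>M)
      \<le> ennreal c * ?I * (ennreal (exp (- (\<Lambda> * (r - s))) * (1 / sqrt (r - s) + sqrt (2 * A))) * indicator {s<..t} r)"
    proof (cases "r \<in> {s<..t}")
      case True
      define k where "k = real (Suc n) * (fact n * (4 / sqrt \<Lambda>) ^ n * exp (\<Lambda> * (t - r)))"
      have k: "0 \<le> k" using L by (simp add: k_def)
      have k_eq: "k = c * exp (- (\<Lambda> * (r - s)))"
      proof -
        have "exp (\<Lambda> * (t - r)) = exp (\<Lambda> * (t - s)) * exp (- (\<Lambda> * (r - s)))"
          by (simp add: algebra_simps flip: exp_add)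
        then show ?thesis by (simp add: k_def c_def)
      qed
      have r: "0 \<le> r" "s \<le> r" "s < r" "r \<le> t" using True Suc.prems by auto
      have [measurable]: "X r \<in> borel_measurable (F r)" "Z \<in> borel_measurable (F r)"
        using X_adapted r measurable_F_mono[OF Suc.prems(3,1) r(2)] by auto
      have Z\<phi>: "(\<lambda>\<omega>. real (Suc n) * (Z \<omega> * \<phi> r \<omega>)) \<in> borel_measurable (F r)" unfolding \<phi>_def by measurable
      have "(\<integral>\<^sup>+\<omega>. ennreal (Z \<omega> * (real (Suc n) * \<phi> r \<omega> * occupation \<epsilon> x r t \<omega> ^ n)) * indicator {s<..t} r \<partial>M)
        = (\<integral>\<^sup>+\<omega>. ennreal ((real (Suc n) * (Z \<omega> * \<phi> r \<omega>)) * occupation \<epsilon> x r t \<omega> ^ n) \<partial>M)"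
        using True by (simp add: mult_ac)
      also have "\<dots> \<le> ennreal (fact n * (4 / sqrt \<Lambda>) ^ n * exp (\<Lambda> * (t - r)))
          * (\<integral>\<^sup>+\<omega>. ennreal (real (Suc n) * (Z \<omega> * \<phi> r \<omega>)) \<partial>M)"
        using Suc.prems \<phi>_nonneg r by (intro Suc.IH Z\<phi>) auto
      also have "\<dots> = ennreal (fact n * (4 / sqrt \<Lambda>) ^ n * exp (\<Lambda> * (t - r)))
          * (ennreal (real (Suc n)) * (\<integral>\<^sup>+\<omega>. ennreal (Z \<omega> * \<phi> r \<omega>) \<partial>M))"
        unfolding \<phi>_def by (subst nn_integral_cmult[symmetric]) (auto simp: ennreal_mult' simp del: of_nat_Suc)
      also have "\<dots> = ennreal k * (\<integral>\<^sup>+\<omega>. ennreal (Z \<omega> * \<phi> r \<omega>) \<partial>M)"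
        unfolding k_def using L by (simp add: ennreal_mult' mult_ac del: of_nat_Suc)
      \<comment> \<open>The remaining kernel is integrated out conditionally on time
        \<open>s\<close>, uniformly in \<epsilon>; this uniformity later allows the smoothing to be
        removed.\<close>
      also have "\<dots> \<le> ennreal k * (ennreal (1 / sqrt (r - s) + sqrt (2 * A)) * ?I)"
        unfolding \<phi>_def using r Suc.prems A \<epsilon> by (intro mult_left_mono density_bound) auto
      also have "\<dots> = ennreal c * ?I * (ennreal (exp (- (\<Lambda> * (r - s))) * (1 / sqrt (r - s) + sqrt (2 * A))) * indicator {s<..t} r)"
        unfolding k_eq using True c by (simp add: ennreal_mult' mult_ac)
      finally show ?thesis .
    qed simp
  qed
  also have "\<dots> = ennreal c * ?I * (\<integral>\<^sup>+r. (ennreal (exp (- (\<Lambda> * (r - s))) * (1 / sqrt (r - s) + sqrt (2 * A))) * indicator {s<..t} r) \<partial>lborel)"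
    by (rule nn_integral_cmult) measurable
  also have "\<dots> \<le> ennreal c * ?I * ennreal (4 / sqrt \<Lambda>)"
    by (intro mult_left_mono nn_integral_Laplace_bound A) simp
  also have "\<dots> = ennreal (fact (Suc n) * (4 / sqrt \<Lambda>) ^ Suc n * exp (\<Lambda> * (t - s))) * ?I"
  proof -
    have "ennreal (fact (Suc n) * (4 / sqrt \<Lambda>) ^ Suc n * exp (\<Lambda> * (t - s))) = ennreal (c * (4 / sqrt \<Lambda>))"
      unfolding c_def power_Suc by (simp only: mult_ac)
    also have "\<dots> = ennreal c * ennreal (4 / sqrt \<Lambda>)" by (rule ennreal_mult') (rule c)
    finally show ?thesis by (simp only: mult_ac)
  qed
  finally show ?case .
qed

text \<open>In the expanded exponential the factorials cancel against those of the moment bound. The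
  coefficient \<open>sqrt \<Lambda> / 8\<close> is half of the critical
  \<open>sqrt \<Lambda> / 4\<close>, so the series is geometric with ratio 1/2 and sum 2.\<close>

lemma occupation_exp_bound:
  assumes A: "\<And>u. 0 \<le> u \<Longrightarrow> u \<le> t \<Longrightarrow> \<alpha> u \<le> A" "0 < A" "A \<le> \<Lambda>" and \<epsilon>: "0 < \<epsilon>"
    and s: "0 \<le> s" "s \<le> t"
  shows "(\<integral>\<^sup>+\<omega>. ennreal (exp (sqrt \<Lambda> / 8 * occupation \<epsilon> x s t \<omega>)) \<partial>M) \<le> ennreal (2 * exp (\<Lambda> * (t - s)))"
proof -
  define \<theta> where "\<theta> = sqrt \<Lambda> / 8"
  have L: "0 < \<Lambda>" using A by simp
  have \<theta>: "0 < \<theta>" using L by (simp add: \<theta>_def)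
  let ?O = "occupation \<epsilon> x s t"
  have O: "0 \<le> ?O \<omega>" for \<omega> by (rule occupation_nonneg[OF \<epsilon>])
  have "(\<integral>\<^sup>+\<omega>. ennreal (exp (\<theta> * ?O \<omega>)) \<partial>M) = (\<integral>\<^sup>+\<omega>. (\<Sum>n. ennreal (\<theta> ^ n / fact n * ?O \<omega> ^ n)) \<partial>M)"
  proof (rule nn_integral_cong)
    fix \<omega>
    have "(\<lambda>n. (\<theta> * ?O \<omega>) ^ n /\<^sub>R fact n) sums exp (\<theta> * ?O \<omega>)" by (rule exp_converges)
    then have "(\<lambda>n. \<theta> ^ n / fact n * ?O \<omega> ^ n) sums exp (\<theta> * ?O \<omega>)"
      by (simp add: power_mult_distrib field_simps)
    then show "ennreal (exp (\<theta> * ?O \<omega>)) = (\<Sum>n. ennreal (\<theta> ^ n / fact n * ?O \<omega> ^ n))"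
      using \<theta> O by (intro suminf_ennreal_eq[symmetric]) auto
  qed
  also have "\<dots> = (\<Sum>n. \<integral>\<^sup>+\<omega>. ennreal (\<theta> ^ n / fact n * ?O \<omega> ^ n) \<partial>M)"
    by (rule nn_integral_suminf) measurable
  also have "\<dots> \<le> (\<Sum>n. ennreal ((1 / 2) ^ n * exp (\<Lambda> * (t - s))))"
  proof (intro suminf_le allI)
    fix n
    have "(\<integral>\<^sup>+\<omega>. ennreal (\<theta> ^ n / fact n * ?O \<omega> ^ n) \<partial>M)
      \<le> ennreal (fact n * (4 / sqrt \<Lambda>) ^ n * exp (\<Lambda> * (t - s))) * (\<integral>\<^sup>+\<omega>. ennreal (\<theta> ^ n / fact n) \<partial>M)"
      using \<theta> by (intro occupation_moment_bound[OF A \<epsilon> s]) auto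
    also have "\<dots> = ennreal (fact n * (4 / sqrt \<Lambda>) ^ n * exp (\<Lambda> * (t - s)) * (\<theta> ^ n / fact n))"
      using \<theta> L by (subst ennreal_mult) (auto simp: emeasure_space_1)
    also have "fact n * (4 / sqrt \<Lambda>) ^ n * exp (\<Lambda> * (t - s)) * (\<theta> ^ n / fact n) = (4 / sqrt \<Lambda> * \<theta>) ^ n * exp (\<Lambda> * (t - s))"
      by (simp add: power_mult_distrib power_divide)
    also have "4 / sqrt \<Lambda> * \<theta> = 1 / 2" using L by (simp add: \<theta>_def)
    finally show "(\<integral>\<^sup>+\<omega>. ennreal (\<theta> ^ n / fact n * ?O \<omega> ^ n) \<partial>M) \<le> ennreal ((1 / 2) ^ n * exp (\<Lambda> * (t - s)))" .
  qed auto
  also have "\<dots> = ennreal (2 * exp (\<Lambda> * (t - s)))"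
  proof (rule suminf_ennreal_eq)
    show "(\<lambda>n. (1 / 2) ^ n * exp (\<Lambda> * (t - s))) sums (2 * exp (\<Lambda> * (t - s)))"
      using sums_mult2[OF geometric_sums[of "1 / 2 :: real"], of "exp (\<Lambda> * (t - s))"] by simp
  qed simp
  finally show ?thesis by (simp add: \<theta>_def)
qed

end

section \<open>Increments of the local time\<close>

text \<open>Borel-Cantelli in integral form: summable expectations make the series almost surely
  finite, so its terms vanish.\<close>

lemma AE_LIMSEQ_zero_if_summable_nn_integral:
  fixes u :: "nat \<Rightarrow> 'a \<Rightarrow> real"
  assumes [measurable]: "\<And>n. u n \<in> borel_measurable M"
    and nonneg: "\<And>n \<omega>. 0 \<le> u n \<omega>"
    and fin: "(\<Sum>n. \<integral>\<^sup>+\<omega>. ennreal (u n \<omega>) \<partial>M) < \<infinity>"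
  shows "AE \<omega> in M. (\<lambda>n. u n \<omega>) \<longlonglongrightarrow> 0"
proof -
  have "(\<integral>\<^sup>+\<omega>. (\<Sum>n. ennreal (u n \<omega>)) \<partial>M) \<noteq> \<infinity>"
    using fin by (subst nn_integral_suminf) auto
  then have "AE \<omega> in M. (\<Sum>n. ennreal (u n \<omega>)) \<noteq> \<infinity>"
    by (intro nn_integral_PInf_AE) auto
  then show ?thesis
  proof eventually_elim
    case (elim \<omega>)
    then have "summable (\<lambda>n. u n \<omega>)"
      using nonneg by (intro summable_suminf_not_top) auto
    then show ?case by (rule summable_LIMSEQ_zero)
  qed
qed

lemma tendsto_zero_if_square_le:
  fixes a b :: "nat \<Rightarrow> real"
  assumes "b \<longlonglongrightarrow> 0" "\<And>n. (a n)\<^sup>2 \<le> b n"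
  shows "a \<longlonglongrightarrow> 0"
proof -
  have "(\<lambda>n. (a n)\<^sup>2) \<longlonglongrightarrow> 0"
    by (rule tendsto_sandwich[OF _ _ tendsto_const assms(1)]) (use assms(2) in auto)
  then have "(\<lambda>n. sqrt ((a n)\<^sup>2)) \<longlonglongrightarrow> sqrt 0" by (rule tendsto_real_sqrt)
  then show ?thesis by (simp add: tendsto_rabs_zero_iff)
qed

context linear_drift_diffusion
begin

text \<open>Mean square convergence becomes almost sure along a sequence with errors below
  \<open>(1 / 2) ^ n\<close>. The errors at \<open>s\<close> and \<open>t\<close> are added so that
  one sequence serves both times.\<close>

lemma local_time_increment_approx:
  assumes L: "local_time M X x L" and s: "0 \<le> s" "s \<le> t"
  obtains \<epsilon> :: "nat \<Rightarrow> real" where "\<And>n. 0 < \<epsilon> n"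
    "AE \<omega> in M. (\<lambda>n. occupation (\<epsilon> n) x s t \<omega>) \<longlonglongrightarrow> L t \<omega> - L s \<omega>"
proof -
  define D where "D \<epsilon> r \<omega> = (occupation \<epsilon> x 0 r \<omega> - L r \<omega>)\<^sup>2" for \<epsilon> r \<omega>
  have meas: "L r \<in> borel_measurable M"
    and conv: "((\<lambda>\<epsilon>. \<integral>\<^sup>+\<omega>. ennreal (D \<epsilon> r \<omega>) \<partial>M) \<longlongrightarrow> 0) (at_right 0)" if "0 \<le> r" for r
    using L that by (auto simp: local_time_def occupation_def D_def)
  have [measurable]: "L s \<in> borel_measurable M" "L t \<in> borel_measurable M"
    using meas s by auto
  have "((\<lambda>\<epsilon>. (\<integral>\<^sup>+\<omega>. ennreal (D \<epsilon> t \<omega>) \<partial>M) + (\<integral>\<^sup>+\<omega>. ennreal (D \<epsilon> s \<omega>) \<partial>M)) \<longlongrightarrow> 0 + 0) (at_right 0)"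
    using s by (intro tendsto_add conv) auto
  moreover have "(\<integral>\<^sup>+\<omega>. ennreal (D \<epsilon> t \<omega>) \<partial>M) + (\<integral>\<^sup>+\<omega>. ennreal (D \<epsilon> s \<omega>) \<partial>M)
      = (\<integral>\<^sup>+\<omega>. ennreal (D \<epsilon> t \<omega> + D \<epsilon> s \<omega>) \<partial>M)" for \<epsilon>
    by (subst nn_integral_add[symmetric]) (auto simp: D_def ennreal_plus)
  ultimately have lim: "((\<lambda>\<epsilon>. \<integral>\<^sup>+\<omega>. ennreal (D \<epsilon> t \<omega> + D \<epsilon> s \<omega>) \<partial>M) \<longlongrightarrow> 0) (at_right 0)"
    by simp
  have "\<exists>\<epsilon>>0. (\<integral>\<^sup>+\<omega>. ennreal (D \<epsilon> t \<omega> + D \<epsilon> s \<omega>) \<partial>M) < ennreal ((1 / 2) ^ n)" for n :: nat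
  proof -
    have "\<forall>\<^sub>F \<epsilon> in at_right 0. (\<integral>\<^sup>+\<omega>. ennreal (D \<epsilon> t \<omega> + D \<epsilon> s \<omega>) \<partial>M) < ennreal ((1 / 2) ^ n)"
      by (rule order_tendstoD(2)[OF lim]) simp
    then have "\<forall>\<^sub>F \<epsilon> in at_right 0. 0 < \<epsilon> \<and> (\<integral>\<^sup>+\<omega>. ennreal (D \<epsilon> t \<omega> + D \<epsilon> s \<omega>) \<partial>M) < ennreal ((1 / 2) ^ n)"
      using eventually_at_right_less[of 0] by eventually_elim simp
    then show ?thesis
      using eventually_happens trivial_limit_at_right_real by blast
  qed
  then obtain \<epsilon> where \<epsilon>: "\<And>n. 0 < \<epsilon> n"
    "\<And>n. (\<integral>\<^sup>+\<omega>. ennreal (D (\<epsilon> n) t \<omega> + D (\<epsilon> n) s \<omega>) \<partial>M) < ennreal ((1 / 2) ^ n)"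
    by metis
  have "AE \<omega> in M. (\<lambda>n. D (\<epsilon> n) t \<omega> + D (\<epsilon> n) s \<omega>) \<longlonglongrightarrow> 0"
  proof (rule AE_LIMSEQ_zero_if_summable_nn_integral)
    have "(\<Sum>n. \<integral>\<^sup>+\<omega>. ennreal (D (\<epsilon> n) t \<omega> + D (\<epsilon> n) s \<omega>) \<partial>M) \<le> (\<Sum>n. ennreal ((1 / 2) ^ n))"
      using \<epsilon>(2) by (intro suminf_le) (auto intro: less_imp_le)
    also have "\<dots> = ennreal 2"
      using geometric_sums[of "1 / 2 :: real"] by (intro suminf_ennreal_eq) auto
    finally show "(\<Sum>n. \<integral>\<^sup>+\<omega>. ennreal (D (\<epsilon> n) t \<omega> + D (\<epsilon> n) s \<omega>) \<partial>M) < \<infinity>"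
      by (rule le_less_trans) simp
  qed (auto simp: D_def)
  then have "AE \<omega> in M. (\<lambda>n. occupation (\<epsilon> n) x s t \<omega>) \<longlonglongrightarrow> L t \<omega> - L s \<omega>"
  proof eventually_elim
    case (elim \<omega>)
    have "(\<lambda>n. occupation (\<epsilon> n) x 0 r \<omega>) \<longlonglongrightarrow> L r \<omega>" if "r = s \<or> r = t" for r
    proof (rule LIM_zero_cancel)
      show "(\<lambda>n. occupation (\<epsilon> n) x 0 r \<omega> - L r \<omega>) \<longlonglongrightarrow> 0"
        by (rule tendsto_zero_if_square_le[OF elim]) (use that in \<open>auto simp: D_def\<close>)
    qed
    then have "(\<lambda>n. occupation (\<epsilon> n) x 0 t \<omega> - occupation (\<epsilon> n) x 0 s \<omega>) \<longlonglongrightarrow> L t \<omega> - L s \<omega>"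
      by (intro tendsto_diff) auto
    then show ?case using occupation_add[OF s] by simp
  qed
  with \<epsilon>(1) show ?thesis by (rule that)
qed

lemma local_time_mono:
  assumes "local_time M X x L" "0 \<le> s" "s \<le> t"
  shows "AE \<omega> in M. L s \<omega> \<le> L t \<omega>"
proof -
  from local_time_increment_approx[OF assms] obtain \<epsilon> where \<epsilon>: "\<And>n::nat. 0 < \<epsilon> n"
    "AE \<omega> in M. (\<lambda>n. occupation (\<epsilon> n) x s t \<omega>) \<longlonglongrightarrow> L t \<omega> - L s \<omega>" by blast
  from \<epsilon>(2) show ?thesis
  proof eventually_elim
    case (elim \<omega>)
    have "0 \<le> L t \<omega> - L s \<omega>"
      by (rule LIMSEQ_le_const[OF elim]) (use occupation_nonneg[OF \<epsilon>(1)] in auto)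
    then show ?case by simp
  qed
qed

lemma local_time_measurable: "local_time M X x L \<Longrightarrow> 0 \<le> t \<Longrightarrow> L t \<in> borel_measurable M"
  by (simp add: local_time_def)

text \<open>The bound for smoothed occupation integrals does not involve \<epsilon>, so Fatou's
  lemma carries it over to the limit.\<close>

lemma local_time_exp_bound:
  assumes L: "local_time M X x L"
    and A: "\<And>u. 0 \<le> u \<Longrightarrow> u \<le> t \<Longrightarrow> \<alpha> u \<le> A" "0 < A" "A \<le> \<Lambda>" and s: "0 \<le> s" "s \<le> t"
  shows "(\<integral>\<^sup>+\<omega>. ennreal (exp (sqrt \<Lambda> / 8 * (L t \<omega> - L s \<omega>))) \<partial>M) \<le> ennreal (2 * exp (\<Lambda> * (t - s)))"
proof -
  from local_time_increment_approx[OF L s] obtain \<epsilon> where \<epsilon>: "\<And>n::nat. 0 < \<epsilon> n"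
    "AE \<omega> in M. (\<lambda>n. occupation (\<epsilon> n) x s t \<omega>) \<longlonglongrightarrow> L t \<omega> - L s \<omega>" by blast
  let ?f = "\<lambda>n \<omega>. ennreal (exp (sqrt \<Lambda> / 8 * occupation (\<epsilon> n) x s t \<omega>))"
  have "AE \<omega> in M. ennreal (exp (sqrt \<Lambda> / 8 * (L t \<omega> - L s \<omega>))) = liminf (\<lambda>n. ?f n \<omega>)"
    using \<epsilon>(2)
  proof eventually_elim
    case (elim \<omega>)
    have "(\<lambda>n. ?f n \<omega>) \<longlonglongrightarrow> ennreal (exp (sqrt \<Lambda> / 8 * (L t \<omega> - L s \<omega>)))"
      by (intro tendsto_ennrealI tendsto_exp tendsto_mult tendsto_const elim)
    then show ?case by (rule lim_imp_Liminf[OF trivial_limit_sequentially, symmetric])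
  qed
  then have "(\<integral>\<^sup>+\<omega>. ennreal (exp (sqrt \<Lambda> / 8 * (L t \<omega> - L s \<omega>))) \<partial>M) = (\<integral>\<^sup>+\<omega>. liminf (\<lambda>n. ?f n \<omega>) \<partial>M)"
    by (rule nn_integral_cong_AE)
  also have "\<dots> \<le> liminf (\<lambda>n. \<integral>\<^sup>+\<omega>. ?f n \<omega> \<partial>M)"
    by (rule nn_integral_liminf) measurable
  also have "\<dots> \<le> ennreal (2 * exp (\<Lambda> * (t - s)))"
    using occupation_exp_bound[OF A \<epsilon>(1) s] by (intro Liminf_le) auto
  finally show ?thesis .
qed

text \<open>Uses \<open>y \<le> exp y\<close>. With \<Lambda> of order \<open>1 / (t - s)\<close>
  the mean increment is of order \<open>sqrt (t - s)\<close>, which is summable along dyadic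
  scales.\<close>

lemma local_time_L1_bound:
  assumes L: "local_time M X x L"
    and A: "\<And>u. 0 \<le> u \<Longrightarrow> u \<le> t \<Longrightarrow> \<alpha> u \<le> A" "0 < A" "A \<le> \<Lambda>" and s: "0 \<le> s" "s \<le> t"
  shows "(\<integral>\<^sup>+\<omega>. ennreal \<bar>L t \<omega> - L s \<omega>\<bar> \<partial>M) \<le> ennreal (16 / sqrt \<Lambda> * exp (\<Lambda> * (t - s)))"
proof -
  have La: "0 < \<Lambda>" using A by simp
  have [measurable]: "L s \<in> borel_measurable M" "L t \<in> borel_measurable M"
    using local_time_measurable[OF L] s by auto
  have "AE \<omega> in M. ennreal \<bar>L t \<omega> - L s \<omega>\<bar> \<le> ennreal (8 / sqrt \<Lambda>) * ennreal (exp (sqrt \<Lambda> / 8 * (L t \<omega> - L s \<omega>)))"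
    using local_time_mono[OF L s]
  proof eventually_elim
    case (elim \<omega>)
    define y where "y = sqrt \<Lambda> / 8 * (L t \<omega> - L s \<omega>)"
    have "\<bar>L t \<omega> - L s \<omega>\<bar> = 8 / sqrt \<Lambda> * y" using La elim by (simp add: y_def)
    also have "\<dots> \<le> 8 / sqrt \<Lambda> * exp y"
    proof (rule mult_left_mono)
      show "y \<le> exp y" using exp_ge_add_one_self[of y] by linarith
    qed (use La in simp)
    finally show ?case
      using La unfolding y_def by (subst ennreal_mult[symmetric]) (auto intro!: ennreal_leI)
  qed
  then have "(\<integral>\<^sup>+\<omega>. ennreal \<bar>L t \<omega> - L s \<omega>\<bar> \<partial>M)
    \<le> (\<integral>\<^sup>+\<omega>. ennreal (8 / sqrt \<Lambda>) * ennreal (exp (sqrt \<Lambda> / 8 * (L t \<omega> - L s \<omega>))) \<partial>M)"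
    by (rule nn_integral_mono_AE)
  also have "\<dots> = ennreal (8 / sqrt \<Lambda>) * (\<integral>\<^sup>+\<omega>. ennreal (exp (sqrt \<Lambda> / 8 * (L t \<omega> - L s \<omega>))) \<partial>M)"
    by (rule nn_integral_cmult) measurable
  also have "\<dots> \<le> ennreal (8 / sqrt \<Lambda>) * ennreal (2 * exp (\<Lambda> * (t - s)))"
    by (intro mult_left_mono local_time_exp_bound[OF L A s]) simp_all
  also have "\<dots> = ennreal (16 / sqrt \<Lambda> * exp (\<Lambda> * (t - s)))"
    using La by (subst ennreal_mult[symmetric]) auto
  finally show ?thesis .
qed

end

section \<open>Dyadic approximation\<close>

text \<open>Rounding up makes the approximations nonincreasing in \<open>n\<close>;
  \<open>nat\<close> keeps the value a nonnegative grid point even for negative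
  \<open>t\<close>.\<close>

definition dyadic_above :: "nat \<Rightarrow> real \<Rightarrow> real" where
  "dyadic_above n t = real (nat \<lceil>2 ^ n * t\<rceil>) / 2 ^ n"

definition dyadics :: "real set" where
  "dyadics = (\<Union>n. range (\<lambda>i::nat. real i / 2 ^ n))"

lemma countable_dyadics: "countable dyadics"
  unfolding dyadics_def by auto

lemma dyadics_nonneg: "a \<in> dyadics \<Longrightarrow> 0 \<le> a"
  by (auto simp: dyadics_def)

lemma dyadic_in_dyadics: "real i / 2 ^ n \<in> dyadics"
  by (auto simp: dyadics_def)

lemma dyadic_above_in_dyadics: "dyadic_above n t \<in> dyadics"
  unfolding dyadic_above_def by (rule dyadic_in_dyadics)

lemma dyadic_above_ge: "0 \<le> t \<Longrightarrow> t \<le> dyadic_above n t"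
proof -
  have "2 ^ n * t \<le> real (nat \<lceil>2 ^ n * t\<rceil>)" by linarith
  then show ?thesis by (simp add: dyadic_above_def field_simps)
qed

lemma dyadic_above_le: "0 \<le> t \<Longrightarrow> dyadic_above n t - t \<le> 1 / 2 ^ n"
proof -
  assume t: "0 \<le> t"
  then have "0 \<le> 2 ^ n * t" by simp
  then have "real (nat \<lceil>2 ^ n * t\<rceil>) \<le> 2 ^ n * t + 1" by linarith
  then have "real (nat \<lceil>2 ^ n * t\<rceil>) / 2 ^ n \<le> (2 ^ n * t + 1) / 2 ^ n" by (rule divide_right_mono) simp
  then show ?thesis by (simp add: dyadic_above_def add_divide_distrib)
qed

lemma dyadic_above_mono: "s \<le> t \<Longrightarrow> dyadic_above n s \<le> dyadic_above n t"
  unfolding dyadic_above_def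
  by (intro divide_right_mono of_nat_mono nat_mono ceiling_mono mult_left_mono) auto

text \<open>A point of the coarser grid lies on the finer grid as well, where
  \<open>dyadic_above n t\<close> is the least nonnegative point that is not below
  \<open>t\<close>.\<close>

lemma dyadic_above_le_dyadic:
  assumes "t \<le> real j / 2 ^ l" "l \<le> n"
  shows "dyadic_above n t \<le> real j / 2 ^ l"
proof -
  have pow: "(2::real) ^ n = 2 ^ (n - l) * 2 ^ l" using assms(2) by (simp flip: power_add)
  have "2 ^ n * t \<le> 2 ^ n * (real j / 2 ^ l)" using assms(1) by (intro mult_left_mono) auto
  also have "\<dots> = real (j * 2 ^ (n - l))" unfolding pow by simp
  finally have "nat \<lceil>2 ^ n * t\<rceil> \<le> j * 2 ^ (n - l)" by linarith
  then have "real (nat \<lceil>2 ^ n * t\<rceil>) / 2 ^ n \<le> real (j * 2 ^ (n - l)) / 2 ^ n"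
    by (intro divide_right_mono of_nat_mono) auto
  also have "\<dots> = real j / 2 ^ l" unfolding pow by simp
  finally show ?thesis by (simp add: dyadic_above_def)
qed

lemma dyadic_above_Suc_le: "dyadic_above (Suc n) t \<le> dyadic_above n t"
proof -
  have "t \<le> dyadic_above n t"
    unfolding dyadic_above_def by (simp add: field_simps) linarith
  then show ?thesis
    using dyadic_above_le_dyadic[of t "nat \<lceil>2 ^ n * t\<rceil>" n "Suc n"] by (simp add: dyadic_above_def)
qed

text \<open>Monotonicity on the countable set \<open>dyadics\<close>, with the lower bound
  \<open>g 0\<close>, gives convergence for all of the uncountably many \<open>t\<close> at
  once.\<close>

lemma dyadic_limit:
  fixes g :: "real \<Rightarrow> real"
  assumes mono: "\<And>a b. a \<in> dyadics \<Longrightarrow> b \<in> dyadics \<Longrightarrow> a \<le> b \<Longrightarrow> g a \<le> g b"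
  shows "(\<lambda>n. g (dyadic_above n t)) \<longlonglongrightarrow> lim (\<lambda>n. g (dyadic_above n t))"
proof -
  have "decseq (\<lambda>n. g (dyadic_above n t))"
    by (intro decseq_SucI mono dyadic_above_in_dyadics dyadic_above_Suc_le)
  moreover have "g 0 \<le> g (dyadic_above n t)" for n
    using dyadic_in_dyadics[of 0 0]
    by (intro mono dyadic_above_in_dyadics) (auto simp: dyadic_above_def)
  ultimately have "convergent (\<lambda>n. g (dyadic_above n t))"
    by (metis convergentI decseq_convergent)
  then show ?thesis by (simp add: convergent_LIMSEQ_iff)
qed

lemma ex_dyadic_scale:
  fixes d :: real
  assumes "0 < d" "d < 1"
  obtains l :: nat where "1 / 2 ^ Suc l \<le> d" "d < 1 / 2 ^ l"
proof -
  obtain n where n: "(1 / 2 :: real) ^ n < d"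
    using real_arch_pow_inv[OF assms(1), of "1 / 2"] by auto
  define m where "m = (LEAST n. (1 / 2 :: real) ^ n \<le> d)"
  have m: "(1 / 2) ^ m \<le> d"
    unfolding m_def by (rule LeastI[of _ n]) (use n in simp)
  then have "m \<noteq> 0" using assms by (metis not_le power_0)
  then obtain l where l: "m = Suc l" by (cases m) auto
  have "\<not> (1 / 2) ^ l \<le> d"
    using not_less_Least[of l "\<lambda>n. (1 / 2) ^ n \<le> d"] l unfolding m_def[symmetric] by simp
  then show ?thesis using m l by (intro that[of l]) (auto simp: power_one_over field_simps)
qed

text \<open>The deterministic core. With \<open>d = t - s\<close> and \<open>l\<close> such that
  \<open>d\<close> lies between 2^-(l + 1) and 2^-l, the lower bound on \<open>d\<close> turns the
  scale into \<open>sqrt d\<close>, while the upper bound and \<open>ln 2 \<ge> 1 / 2\<close> give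
  \<open>l \<le> 2 * ln (1 / d)\<close>. The term \<open>l\<close> inside \<open>q\<close> thus
  becomes the logarithm.\<close>

lemma dyadic_limit_modulus:
  fixes g :: "real \<Rightarrow> real" and k :: nat
  assumes mono: "\<And>a b. a \<in> dyadics \<Longrightarrow> b \<in> dyadics \<Longrightarrow> a \<le> b \<Longrightarrow> g a \<le> g b"
    and incr: "\<And>n i. i < k * 2 ^ n \<Longrightarrow> g (real (Suc i) / 2 ^ n) - g (real i / 2 ^ n)
      \<le> 8 * (3 * (A + real n + real k) + S) / sqrt ((A + real n + real k) * 2 ^ n)"
    and AS: "0 \<le> A" "0 \<le> S"
    and st: "0 \<le> s" "s < t" "t \<le> real k" "t - s < 1"
  shows "\<bar>lim (\<lambda>n. g (dyadic_above n t)) - lim (\<lambda>n. g (dyadic_above n s))\<bar>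
    \<le> 32 * (3 + S) * (sqrt (t - s) * (sqrt (A + real k) + sqrt (ln (1 / (t - s)))))"
proof -
  define d where "d = t - s"
  have d: "0 < d" "d < 1" using st by (auto simp: d_def)
  from ex_dyadic_scale[OF d] obtain l :: nat where l: "1 / 2 ^ Suc l \<le> d" "d < 1 / 2 ^ l" by blast
  define i j where "i = nat \<lfloor>2 ^ l * s\<rfloor>" and "j = nat \<lceil>2 ^ l * t\<rceil>"
  define q where "q = A + real l + real k"
  define B where "B = 8 * (3 * q + S) / sqrt (q * 2 ^ l)"
  let ?lt = "lim (\<lambda>n. g (dyadic_above n t))" and ?ls = "lim (\<lambda>n. g (dyadic_above n s))"
  have k: "1 \<le> k" using st by (cases k) auto
  have q: "1 \<le> q" using k AS by (simp add: q_def)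
  have B: "0 \<le> B" using AS q by (simp add: B_def)
  have s2: "0 \<le> 2 ^ l * s" using st by simp
  have i_le: "real i / 2 ^ l \<le> s"
  proof -
    have "real i \<le> 2 ^ l * s" using s2 unfolding i_def by linarith
    then show ?thesis by (simp add: field_simps)
  qed
  have j_ge: "t \<le> real j / 2 ^ l"
  proof -
    have "2 ^ l * t \<le> real j" unfolding j_def by linarith
    then show ?thesis by (simp add: field_simps)
  qed
  \<comment> \<open>\<open>s\<close> is rounded down, \<open>t\<close> is rounded up, and they are
    less than one grid step apart: at most two grid intervals are met.\<close>
  have "2 ^ l * t < 2 ^ l * s + 1" using l(2) by (simp add: d_def field_simps)
  then have j_le: "j \<le> i + 2" using s2 unfolding i_def j_def by linarith
  have "2 ^ l * t \<le> 2 ^ l * real k" using st by (intro mult_left_mono) auto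
  then have "2 ^ l * t \<le> real (k * 2 ^ l)" by (simp add: mult.commute)
  then have jk: "j \<le> k * 2 ^ l" unfolding j_def by linarith
  have ij: "g (real j / 2 ^ l) - g (real i / 2 ^ l) \<le> 2 * B"
  proof -
    have step: "g (real (Suc m) / 2 ^ l) - g (real m / 2 ^ l) \<le> B" if "m < j" for m
      unfolding B_def q_def using that jk by (intro incr) auto
    have "real i / 2 ^ l < real j / 2 ^ l" using i_le j_ge st by linarith
    then have "i < j" by (simp add: divide_less_cancel)
    then consider "j = Suc i" | "j = Suc (Suc i)" using j_le by linarith
    then show ?thesis
    proof cases
      case 1 then show ?thesis using step[of i] B by simp
    next
      case 2 then show ?thesis using step[of i] step[of "Suc i"] by simp
    qed
  qed
  have "?lt \<le> g (real j / 2 ^ l)"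
  proof (rule LIMSEQ_le_const2[OF dyadic_limit[OF mono]])
    show "\<exists>N. \<forall>n\<ge>N. g (dyadic_above n t) \<le> g (real j / 2 ^ l)"
      by (intro exI[of _ l] allI impI mono dyadic_above_in_dyadics dyadic_in_dyadics dyadic_above_le_dyadic j_ge)
  qed
  moreover have "g (real i / 2 ^ l) \<le> ?ls"
  proof (rule LIMSEQ_le_const[OF dyadic_limit[OF mono]])
    show "\<exists>N. \<forall>n\<ge>N. g (real i / 2 ^ l) \<le> g (dyadic_above n s)"
      using dyadic_above_ge[OF st(1)] i_le
      by (intro exI[of _ l] allI impI mono dyadic_above_in_dyadics dyadic_in_dyadics) (rule order_trans)
  qed
  moreover have "?ls \<le> ?lt"
    using st by (intro LIMSEQ_le[OF dyadic_limit[OF mono] dyadic_limit[OF mono]])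
      (auto intro!: mono dyadic_above_in_dyadics dyadic_above_mono)
  ultimately have "\<bar>?lt - ?ls\<bar> \<le> 2 * B" using ij by linarith
  also have "2 * B \<le> 16 * (3 + S) * (sqrt q * (1 / sqrt (2 ^ l)))"
  proof -
    \<comment> \<open>\<open>q \<ge> 1\<close> lets \<open>S\<close> be absorbed into a multiple of
      \<open>q\<close>, so that after division only \<open>sqrt q\<close> remains.\<close>
    have "3 * q + S \<le> (3 + S) * q" using q AS mult_left_mono[of 1 q S] by (simp add: algebra_simps)
    then have "2 * B \<le> 16 * ((3 + S) * q) / sqrt (q * 2 ^ l)"
      unfolding B_def using q by (simp add: divide_right_mono)
    also have "\<dots> = 16 * (3 + S) * ((q / sqrt q) * (1 / sqrt (2 ^ l)))"
      using q by (simp add: real_sqrt_mult)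
    also have "q / sqrt q = sqrt q" using q by (simp add: real_div_sqrt)
    finally show ?thesis .
  qed
  also have "\<dots> \<le> 16 * (3 + S) * ((sqrt (A + real k) + sqrt 2 * sqrt (ln (1 / d))) * (sqrt 2 * sqrt d))"
  proof -
    have "1 / 2 ^ l \<le> 2 * d" using l(1) by (simp add: field_simps)
    then have "sqrt (1 / 2 ^ l) \<le> sqrt (2 * d)" by (rule real_sqrt_le_mono)
    then have dl: "1 / sqrt (2 ^ l) \<le> sqrt 2 * sqrt d" by (simp add: real_sqrt_divide real_sqrt_mult)
    have "2 ^ l < 1 / d" using l(2) d by (simp add: field_simps)
    then have "ln (2 ^ l) \<le> ln (1 / d)" using d by (subst ln_le_cancel_iff) auto
    then have "real l * ln 2 \<le> ln (1 / d)" by (simp add: ln_realpow)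
    moreover have "real l * (1 / 2) \<le> real l * ln 2" using ln2_ge_two_thirds by (intro mult_left_mono) auto
    ultimately have "real l \<le> 2 * ln (1 / d)" by linarith
    then have "sqrt (real l) \<le> sqrt (2 * ln (1 / d))" by (rule real_sqrt_le_mono)
    then have "sqrt (real l) \<le> sqrt 2 * sqrt (ln (1 / d))" by (simp add: real_sqrt_mult)
    moreover have "sqrt q \<le> sqrt (A + real k) + sqrt (real l)"
      using sqrt_add_le_add_sqrt[of "A + real k" "real l"] AS by (simp add: q_def add_ac)
    ultimately have "sqrt q \<le> sqrt (A + real k) + sqrt 2 * sqrt (ln (1 / d))" by linarith
    then show ?thesis
      using dl AS d q by (intro mult_left_mono mult_mono) auto
  qed
  also have "\<dots> \<le> 32 * (3 + S) * (sqrt d * (sqrt (A + real k) + sqrt (ln (1 / d))))"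
  proof -
    have s2': "sqrt 2 \<le> (2::real)" by (intro real_le_lsqrt) auto
    have ln0: "0 \<le> sqrt (ln (1 / d))" using d by simp
    have "(sqrt (A + real k) + sqrt 2 * sqrt (ln (1 / d))) * (sqrt 2 * sqrt d)
      = (sqrt 2 * sqrt (A + real k) + 2 * sqrt (ln (1 / d))) * sqrt d"
      by (simp add: algebra_simps)
    also have "\<dots> \<le> (2 * sqrt (A + real k) + 2 * sqrt (ln (1 / d))) * sqrt d"
      using s2' AS d by (intro mult_right_mono add_right_mono) auto
    finally have "16 * (3 + S) * ((sqrt (A + real k) + sqrt 2 * sqrt (ln (1 / d))) * (sqrt 2 * sqrt d))
      \<le> 16 * (3 + S) * ((2 * sqrt (A + real k) + 2 * sqrt (ln (1 / d))) * sqrt d)"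
      using AS by (intro mult_left_mono) auto
    also have "\<dots> = 32 * (3 + S) * (sqrt d * (sqrt (A + real k) + sqrt (ln (1 / d))))"
      by (simp add: algebra_simps)
    finally show ?thesis .
  qed
  finally show ?thesis by (simp add: d_def)
qed

section \<open>Modulus of continuity\<close>

lemma running_sup_mono: "T \<le> T' \<Longrightarrow> running_sup \<alpha> T \<le> running_sup \<alpha> T'"
  unfolding running_sup_def by (intro SUP_subset_mono) auto

lemma le_running_sup:
  assumes "running_sup \<alpha> T < \<infinity>" "0 \<le> u" "u \<le> T" "0 \<le> \<alpha> u"
  shows "\<alpha> u \<le> enn2real (running_sup \<alpha> T)"
proof -
  have "ennreal (\<alpha> u) \<le> running_sup \<alpha> T"
    unfolding running_sup_def using assms by (intro SUP_upper) auto
  then have "enn2real (ennreal (\<alpha> u)) \<le> enn2real (running_sup \<alpha> T)"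
    using assms(1) by (intro enn2real_mono) (auto simp: infinity_ennreal_def)
  then show ?thesis using assms by simp
qed

text \<open>\<open>exp 2 \<ge> 4\<close> yields a factor 1/4 per unit of \<open>n\<close> and of
  \<open>k\<close>; half of this decay pays for \<open>2 ^ n\<close> and for
  \<open>k \<le> 2 ^ k\<close>.\<close>

lemma nat_times_exp_le:
  fixes q :: real and k n :: nat
  assumes "real n + real k \<le> q"
  shows "real (k * 2 ^ n) * (2 * exp (- 2 * q)) \<le> 2 * (1 / 2) ^ k * (1 / 2) ^ n"
proof -
  have "exp (- 2 :: real) = 1 / (exp 1)\<^sup>2"
    by (simp add: exp_minus power2_eq_square field_simps flip: exp_add)
  also have "\<dots> \<le> 1 / 2\<^sup>2"
    using exp_ge_add_one_self[of 1] by (intro divide_left_mono power_mono mult_pos_pos) auto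
  finally have e: "exp (- 2 :: real) \<le> 1 / 4" by simp
  have "exp (- 2 * q) \<le> exp (- 2 * (real n + real k))" using assms by simp
  also have "\<dots> = exp (- 2) ^ n * exp (- 2) ^ k"
    by (simp add: exp_of_nat_mult[symmetric] exp_add[symmetric] algebra_simps)
  also have "\<dots> \<le> (1 / 4) ^ n * (1 / 4) ^ k"
    using e by (intro mult_mono power_mono) auto
  finally have "real (k * 2 ^ n) * (2 * exp (- 2 * q)) \<le> real (k * 2 ^ n) * (2 * ((1 / 4) ^ n * (1 / 4) ^ k))"
    by (intro mult_left_mono) auto
  also have "\<dots> \<le> (2 ^ k * 2 ^ n) * (2 * ((1 / 4) ^ n * (1 / 4) ^ k))"
    using less_imp_le[OF of_nat_less_two_power[of k, where 'a=real]] by (intro mult_right_mono) auto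
  also have "\<dots> = 2 * ((2 * (1 / 4)) ^ k * (2 * (1 / 4)) ^ n)"
    unfolding power_mult_distrib by (simp only: mult_ac)
  finally show ?thesis by simp
qed

section \<open>The random constant and the modification\<close>

context linear_drift_diffusion
begin

text \<open>The quantity q of the overview. For an infinite supremum \<open>enn2real\<close> returns
  0; \<open>dyadic_term\<close> discards such horizons.\<close>

definition resolution :: "nat \<Rightarrow> nat \<Rightarrow> real" where
  "resolution k n = enn2real (running_sup \<alpha> (real k)) + real n + real k"

definition dyadic_term :: "(real \<Rightarrow> 'a \<Rightarrow> real) \<Rightarrow> nat \<Rightarrow> nat \<Rightarrow> nat \<Rightarrow> 'a \<Rightarrow> ennreal" where
  "dyadic_term L k n i \<omega> = (if running_sup \<alpha> (real k) < \<infinity> then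
     ennreal (exp (sqrt (resolution k n * 2 ^ n) / 8 * (L (real (Suc i) / 2 ^ n) \<omega> - L (real i / 2 ^ n) \<omega>)
       - 3 * resolution k n)) else 0)"

text \<open>One random number controls all horizons \<open>k\<close>, scales \<open>n\<close> and
  positions \<open>i\<close>; this is why the final constant does not depend on
  \<open>T\<close>.\<close>

definition dyadic_sum :: "(real \<Rightarrow> 'a \<Rightarrow> real) \<Rightarrow> 'a \<Rightarrow> ennreal" where
  "dyadic_sum L \<omega> = (\<Sum>k. \<Sum>n. \<Sum>i<k * 2 ^ n. dyadic_term L k n i \<omega>)"

lemma running_sup_pos: "0 \<le> T \<Longrightarrow> running_sup \<alpha> T < \<infinity> \<Longrightarrow> 0 < enn2real (running_sup \<alpha> T)"
  using le_running_sup[of \<alpha> T 0] \<alpha>_pos[of 0] by simp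

lemma dyadic_term_measurable [measurable]:
  assumes "local_time M X x L"
  shows "dyadic_term L k n i \<in> borel_measurable M"
proof -
  have [measurable]: "L (real (Suc i) / 2 ^ n) \<in> borel_measurable M" "L (real i / 2 ^ n) \<in> borel_measurable M"
    using local_time_measurable[OF assms] by auto
  show ?thesis unfolding dyadic_term_def[abs_def] by measurable
qed

lemma dyadic_sum_measurable:
  assumes "local_time M X x L"
  shows "dyadic_sum L \<in> borel_measurable M"
proof -
  note [measurable] = dyadic_term_measurable[OF assms]
  show ?thesis unfolding dyadic_sum_def[abs_def] by measurable
qed

lemma nn_integral_dyadic_term:
  assumes L: "local_time M X x L" and i: "i < k * 2 ^ n"
  shows "(\<integral>\<^sup>+\<omega>. dyadic_term L k n i \<omega> \<partial>M) \<le> ennreal (2 * exp (- 2 * resolution k n))"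
proof (cases "running_sup \<alpha> (real k) < \<infinity>")
  case True
  define q where "q = resolution k n"
  define a b where "a = real i / 2 ^ n" and "b = real (Suc i) / 2 ^ n"
  define A where "A = enn2real (running_sup \<alpha> (real k))"
  have ab: "0 \<le> a" "a \<le> b" "b - a = 1 / 2 ^ n"
    by (auto simp: a_def b_def divide_right_mono diff_divide_distrib[symmetric])
  have [measurable]: "L a \<in> borel_measurable M" "L b \<in> borel_measurable M"
    using local_time_measurable[OF L] ab by auto
  have "real (Suc i) \<le> real (k * 2 ^ n)" using i by (intro of_nat_mono) simp
  then have b_le: "b \<le> real k" by (simp add: b_def field_simps)
  have A: "\<alpha> u \<le> A" if "0 \<le> u" "u \<le> b" for u
    unfolding A_def using that b_le True \<alpha>_nonneg by (intro le_running_sup) auto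
  have A0: "0 < A" unfolding A_def using True by (intro running_sup_pos) auto
  \<comment> \<open>The choice \<open>\<Lambda> = q * 2 ^ n\<close> is admissible in the exponential
    bound only if it dominates \<open>A\<close>.\<close>
  have Aq: "A \<le> q * 2 ^ n"
  proof -
    have "A \<le> q" by (simp add: A_def q_def resolution_def)
    also have "q * 1 \<le> q * 2 ^ n" using \<open>A \<le> q\<close> A0 by (intro mult_left_mono) auto
    finally show ?thesis by simp
  qed
  have "(\<integral>\<^sup>+\<omega>. dyadic_term L k n i \<omega> \<partial>M)
    = (\<integral>\<^sup>+\<omega>. ennreal (exp (- (3 * q))) * ennreal (exp (sqrt (q * 2 ^ n) / 8 * (L b \<omega> - L a \<omega>))) \<partial>M)"
    using True by (simp add: dyadic_term_def q_def a_def b_def ennreal_mult[symmetric] exp_add[symmetric])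
  also have "\<dots> = ennreal (exp (- (3 * q))) * (\<integral>\<^sup>+\<omega>. ennreal (exp (sqrt (q * 2 ^ n) / 8 * (L b \<omega> - L a \<omega>))) \<partial>M)"
    by (rule nn_integral_cmult) measurable
  also have "\<dots> \<le> ennreal (exp (- (3 * q))) * ennreal (2 * exp (q * 2 ^ n * (b - a)))"
    by (intro mult_left_mono local_time_exp_bound[OF L A A0 Aq ab(1,2)]) auto
  also have "\<dots> = ennreal (2 * (exp (- (3 * q)) * exp q))"
    unfolding ab(3) by (subst ennreal_mult[symmetric]) (auto simp: mult_ac)
  also have "exp (- (3 * q)) * exp q = exp (- 2 * q)" by (simp flip: exp_add)
  finally show ?thesis by (simp add: q_def)
qed (simp add: dyadic_term_def)

lemma dyadic_sum_finite:
  assumes L: "local_time M X x L"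
  shows "AE \<omega> in M. dyadic_sum L \<omega> \<noteq> \<infinity>"
proof -
  note [measurable] = dyadic_term_measurable[OF L]
  have "(\<integral>\<^sup>+\<omega>. dyadic_sum L \<omega> \<partial>M) = (\<Sum>k. \<Sum>n. \<Sum>i<k * 2 ^ n. \<integral>\<^sup>+\<omega>. dyadic_term L k n i \<omega> \<partial>M)"
    unfolding dyadic_sum_def by (simp add: nn_integral_suminf nn_integral_sum)
  also have "\<dots> \<le> (\<Sum>k. \<Sum>n. ennreal (2 * (1 / 2) ^ k * (1 / 2) ^ n))"
  proof (intro suminf_le allI)
    fix k n
    have "(\<Sum>i<k * 2 ^ n. \<integral>\<^sup>+\<omega>. dyadic_term L k n i \<omega> \<partial>M) \<le> (\<Sum>i<k * 2 ^ n. ennreal (2 * exp (- 2 * resolution k n)))"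
      by (intro sum_mono nn_integral_dyadic_term[OF L]) simp
    also have "\<dots> = ennreal (real (k * 2 ^ n) * (2 * exp (- 2 * resolution k n)))"
      by (subst sum_ennreal) (auto)
    also have "\<dots> \<le> ennreal (2 * (1 / 2) ^ k * (1 / 2) ^ n)"
      by (intro ennreal_leI nat_times_exp_le) (simp add: resolution_def)
    finally show "(\<Sum>i<k * 2 ^ n. \<integral>\<^sup>+\<omega>. dyadic_term L k n i \<omega> \<partial>M) \<le> ennreal (2 * (1 / 2) ^ k * (1 / 2) ^ n)" .
  qed auto
  also have "\<dots> = (\<Sum>k. ennreal (2 * (1 / 2) ^ k * 2))"
  proof (intro suminf_cong suminf_ennreal_eq)
    show "(\<lambda>n. 2 * (1 / 2) ^ k * (1 / 2) ^ n) sums (2 * (1 / 2) ^ k * (2::real))" for k :: nat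
      using sums_mult[OF geometric_sums[of "1 / 2 :: real"], of "2 * (1 / 2) ^ k"] by simp
  qed simp
  also have "\<dots> = ennreal 8"
  proof (rule suminf_ennreal_eq)
    show "(\<lambda>k. 2 * (1 / 2) ^ k * (2::real)) sums 8"
      using sums_mult[OF geometric_sums[of "1 / 2 :: real"], of 4] by simp
  qed simp
  finally have "(\<integral>\<^sup>+\<omega>. dyadic_sum L \<omega> \<partial>M) < \<infinity>"
    by (rule le_less_trans) simp
  then show ?thesis
    using dyadic_sum_measurable[OF L] by (intro nn_integral_PInf_AE) auto
qed

text \<open>A single term is at most the whole sum, and \<open>y \<le> exp y\<close> releases the
  increment. A logarithm would be sharper, but the sum enters only the random constant.\<close>

lemma dyadic_increment_bound:
  assumes S: "dyadic_sum L \<omega> \<noteq> \<infinity>" and k: "running_sup \<alpha> (real k) < \<infinity>" and i: "i < k * 2 ^ n"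
  shows "L (real (Suc i) / 2 ^ n) \<omega> - L (real i / 2 ^ n) \<omega>
    \<le> 8 * (3 * resolution k n + enn2real (dyadic_sum L \<omega>)) / sqrt (resolution k n * 2 ^ n)"
proof -
  define \<Delta> where "\<Delta> = L (real (Suc i) / 2 ^ n) \<omega> - L (real i / 2 ^ n) \<omega>"
  define \<theta> where "\<theta> = sqrt (resolution k n * 2 ^ n)"
  have "0 < resolution k n" using running_sup_pos[OF _ k] by (simp add: resolution_def add_pos_nonneg)
  then have \<theta>: "0 < \<theta>" by (simp add: \<theta>_def)
  have "dyadic_term L k n i \<omega> \<le> (\<Sum>i<k * 2 ^ n. dyadic_term L k n i \<omega>)"
    using i by (intro member_le_sum) auto
  also have "\<dots> \<le> (\<Sum>n. \<Sum>i<k * 2 ^ n. dyadic_term L k n i \<omega>)"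
    using sum_le_suminf[of "\<lambda>n. \<Sum>i<k * 2 ^ n. dyadic_term L k n i \<omega>" "{n}"] by auto
  also have "\<dots> \<le> dyadic_sum L \<omega>"
    unfolding dyadic_sum_def
    using sum_le_suminf[of "\<lambda>k. \<Sum>n. \<Sum>i<k * 2 ^ n. dyadic_term L k n i \<omega>" "{k}"] by auto
  finally have "ennreal (exp (\<theta> / 8 * \<Delta> - 3 * resolution k n)) \<le> dyadic_sum L \<omega>"
    using k by (simp add: dyadic_term_def \<Delta>_def \<theta>_def)
  then have "exp (\<theta> / 8 * \<Delta> - 3 * resolution k n) \<le> enn2real (dyadic_sum L \<omega>)"
    using S enn2real_mono[of "ennreal (exp (\<theta> / 8 * \<Delta> - 3 * resolution k n))" "dyadic_sum L \<omega>"]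
    by (simp add: infinity_ennreal_def less_top)
  moreover have "\<theta> / 8 * \<Delta> - 3 * resolution k n \<le> exp (\<theta> / 8 * \<Delta> - 3 * resolution k n)"
    using exp_ge_add_one_self[of "\<theta> / 8 * \<Delta> - 3 * resolution k n"] by linarith
  ultimately have "\<theta> * \<Delta> \<le> 8 * (3 * resolution k n + enn2real (dyadic_sum L \<omega>))" by simp
  then show ?thesis
    using \<theta> unfolding \<Delta>_def[symmetric] \<theta>_def[symmetric] by (simp add: field_simps)
qed

text \<open>Where \<open>\<alpha>\<close> is unbounded the density bound gives no continuity of \<open>L\<close>, but the claimed
  estimate is void there, so \<open>L\<close> is kept.\<close>

definition regularized :: "(real \<Rightarrow> 'a \<Rightarrow> real) \<Rightarrow> real \<Rightarrow> 'a \<Rightarrow> real" where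
  "regularized L t \<omega> = (if running_sup \<alpha> (real (nat \<lceil>t\<rceil>)) < \<infinity>
     then lim (\<lambda>n. L (dyadic_above n t) \<omega>) else L t \<omega>)"

text \<open>Right continuity in mean with a rate: for \<open>\<Lambda> = 2 ^ (n + m)\<close> the
  interval is no longer than \<open>1 / \<Lambda>\<close>, so the exponential factor is at most
  \<open>exp 1\<close> and the mean distance decays like \<open>(1 / sqrt 2) ^ n\<close>, which is
  summable.\<close>

lemma local_time_dyadic_above_tendsto:
  assumes L: "local_time M X x L" and t: "0 \<le> t" and fin: "running_sup \<alpha> (real (nat \<lceil>t\<rceil>)) < \<infinity>"
  shows "AE \<omega> in M. (\<lambda>n. L (dyadic_above n t) \<omega>) \<longlonglongrightarrow> L t \<omega>"
proof -
  define k where "k = nat \<lceil>t\<rceil>"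
  define A where "A = enn2real (running_sup \<alpha> (real k))"
  have A0: "0 < A" unfolding A_def using fin by (intro running_sup_pos) (auto simp: k_def)
  \<comment> \<open>Shifting the scales by \<open>m\<close> makes
    \<open>\<Lambda> = 2 ^ (n + m)\<close> exceed \<open>A\<close> for every
    \<open>n\<close>.\<close>
  obtain m :: nat where m: "A < 2 ^ m" using real_arch_pow[of 2 A] by auto
  have meas [measurable]: "L t \<in> borel_measurable M" "L (dyadic_above n t) \<in> borel_measurable M" for n
    using local_time_measurable[OF L] t dyadics_nonneg[OF dyadic_above_in_dyadics] by auto
  have bound: "(\<integral>\<^sup>+\<omega>. ennreal \<bar>L (dyadic_above (n + m) t) \<omega> - L t \<omega>\<bar> \<partial>M) \<le> ennreal (16 * exp 1 * (1 / sqrt 2) ^ n)" for n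
  proof -
    let ?b = "dyadic_above (n + m) t"
    have "t \<le> real k / 2 ^ 0" unfolding k_def by simp linarith
    then have b_le: "?b \<le> real k" using dyadic_above_le_dyadic[of t k 0 "n + m"] by simp
    have A: "\<alpha> u \<le> A" if "0 \<le> u" "u \<le> ?b" for u
      unfolding A_def using that b_le fin \<alpha>_nonneg by (intro le_running_sup) (auto simp: k_def)
    have "(2::real) ^ m \<le> 2 ^ (n + m)" by (intro power_increasing) auto
    then have "A \<le> 2 ^ (n + m)" using m by linarith
    from local_time_L1_bound[OF L A A0 this t dyadic_above_ge[OF t]]
    have "(\<integral>\<^sup>+\<omega>. ennreal \<bar>L ?b \<omega> - L t \<omega>\<bar> \<partial>M) \<le> ennreal (16 / sqrt (2 ^ (n + m)) * exp (2 ^ (n + m) * (?b - t)))" .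
    also have "\<dots> \<le> ennreal (16 / sqrt (2 ^ n) * exp 1)"
    proof (intro ennreal_leI mult_mono)
      have "(2::real) ^ n \<le> 2 ^ (n + m)" by (intro power_increasing) auto
      then show "16 / sqrt (2 ^ (n + m)) \<le> 16 / sqrt (2 ^ n :: real)"
        by (intro divide_left_mono real_sqrt_le_mono mult_pos_pos) auto
      show "exp (2 ^ (n + m) * (?b - t)) \<le> exp 1"
        using dyadic_above_le[OF t, of "n + m"] by (simp add: field_simps)
    qed auto
    also have "16 / sqrt (2 ^ n) * exp 1 = 16 * exp 1 * (1 / sqrt 2 :: real) ^ n"
      by (simp add: real_sqrt_power power_one_over)
    finally show ?thesis .
  qed
  have "AE \<omega> in M. (\<lambda>n. \<bar>L (dyadic_above (n + m) t) \<omega> - L t \<omega>\<bar>) \<longlonglongrightarrow> 0"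
  proof (rule AE_LIMSEQ_zero_if_summable_nn_integral)
    have "summable (\<lambda>n. 16 * exp 1 * (1 / sqrt 2 :: real) ^ n)"
      by (intro summable_mult summable_geometric) auto
    then have "(\<Sum>n. ennreal (16 * exp 1 * (1 / sqrt 2) ^ n)) = ennreal (\<Sum>n. 16 * exp 1 * (1 / sqrt 2) ^ n)"
      by (intro suminf_ennreal2) auto
    then have "(\<Sum>n. ennreal (16 * exp 1 * (1 / sqrt 2) ^ n)) < \<infinity>" by simp
    moreover have "(\<Sum>n. \<integral>\<^sup>+\<omega>. ennreal \<bar>L (dyadic_above (n + m) t) \<omega> - L t \<omega>\<bar> \<partial>M)
        \<le> (\<Sum>n. ennreal (16 * exp 1 * (1 / sqrt 2) ^ n))"
      by (intro suminf_le bound) auto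
    ultimately show "(\<Sum>n. \<integral>\<^sup>+\<omega>. ennreal \<bar>L (dyadic_above (n + m) t) \<omega> - L t \<omega>\<bar> \<partial>M) < \<infinity>"
      by (rule le_less_trans[rotated])
  qed auto
  then show ?thesis
  proof eventually_elim
    case (elim \<omega>)
    then have "(\<lambda>n. L (dyadic_above (n + m) t) \<omega> - L t \<omega>) \<longlonglongrightarrow> 0"
      by (rule tendsto_rabs_zero_cancel)
    then have "(\<lambda>n. L (dyadic_above (n + m) t) \<omega>) \<longlonglongrightarrow> L t \<omega>" by (rule LIM_zero_cancel)
    then show ?case by (rule LIMSEQ_offset)
  qed
qed

lemma modification_regularized:
  assumes L: "local_time M X x L"
  shows "modification M L (regularized L)"
  unfolding modification_def
proof (intro allI impI conjI)
  fix t :: real assume t: "0 \<le> t"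
  have [measurable]: "L t \<in> borel_measurable M" "L (dyadic_above n t) \<in> borel_measurable M" for n
    using local_time_measurable[OF L] t dyadics_nonneg[OF dyadic_above_in_dyadics] by auto
  \<comment> \<open>Measurability holds also where the limit fails to exist, since
    \<open>lim\<close> then takes one fixed value.\<close>
  have "(\<lambda>\<omega>. lim (\<lambda>n. L (dyadic_above n t) \<omega>)) \<in> borel_measurable M"
    by (rule borel_measurable_lim_metric) measurable
  then show "regularized L t \<in> borel_measurable M"
    by (simp add: regularized_def[abs_def])
  show "AE \<omega> in M. regularized L t \<omega> = L t \<omega>"
  proof (cases "running_sup \<alpha> (real (nat \<lceil>t\<rceil>)) < \<infinity>")
    case True
    from local_time_dyadic_above_tendsto[OF L t this] show ?thesis
      by eventually_elim (use True in \<open>simp add: regularized_def limI\<close>)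
  qed (simp add: regularized_def)
qed

text \<open>Each comparison has its own null set; countably many dyadic pairs leave a common one.
  This is the reason for building the modification from dyadic values.\<close>

lemma AE_local_time_mono_dyadics:
  assumes L: "local_time M X x L"
  shows "AE \<omega> in M. \<forall>a\<in>dyadics. \<forall>b\<in>dyadics. a \<le> b \<longrightarrow> L a \<omega> \<le> L b \<omega>"
proof (intro AE_ball_countable' countable_dyadics)
  fix a b assume "a \<in> dyadics" "b \<in> dyadics"
  then show "AE \<omega> in M. a \<le> b \<longrightarrow> L a \<omega> \<le> L b \<omega>"
    using local_time_mono[OF L, of a b] dyadics_nonneg[of a] by (cases "a \<le> b") auto
qed

end

section \<open>The modulus at arbitrary times\<close>

lemma ennreal_le_esqrt_bound:
  assumes "0 \<le> K" "0 \<le> a" "0 \<le> T" "0 \<le> e" "R < \<infinity>"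
    and le: "y \<le> K * (a * sqrt (T * enn2real R) + e)"
  shows "ennreal y \<le> ennreal K * (ennreal a * esqrt (ennreal T * R) + ennreal e)"
proof -
  obtain r where r: "R = ennreal r" "0 \<le> r"
    using assms(5) by (cases R) auto
  have "esqrt (ennreal T * R) = ennreal (sqrt (T * r))"
    using r assms by (simp add: esqrt_def ennreal_mult[symmetric])
  then have "ennreal K * (ennreal a * esqrt (ennreal T * R) + ennreal e)
      = ennreal (K * (a * sqrt (T * r) + e))"
    using assms r by (simp add: ennreal_mult ennreal_plus)
  then show ?thesis using le r by (simp add: ennreal_leI)
qed

context linear_drift_diffusion
begin

lemma regularized_increment_bound:
  assumes S: "dyadic_sum L \<omega> \<noteq> \<infinity>"
    and mono: "\<forall>a\<in>dyadics. \<forall>b\<in>dyadics. a \<le> b \<longrightarrow> L a \<omega> \<le> L b \<omega>"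
    and st: "0 \<le> s" "s < t" "t \<le> T" "t - s < 1" and fin: "running_sup \<alpha> (T + 1) < \<infinity>"
  shows "\<bar>regularized L t \<omega> - regularized L s \<omega>\<bar>
    \<le> 32 * (1 + 1 / \<alpha> 0) * (3 + enn2real (dyadic_sum L \<omega>))
      * (sqrt (t - s) * sqrt ((T + 1) * enn2real (running_sup \<alpha> (T + 1))) + sqrt (t - s) * sqrt (ln (1 / (t - s))))"
proof -
  define k where "k = nat \<lceil>T\<rceil>"
  define A where "A = enn2real (running_sup \<alpha> (real k))"
  define R where "R = enn2real (running_sup \<alpha> (T + 1))"
  define S' where "S' = enn2real (dyadic_sum L \<omega>)"
  have T: "0 < T" using st by simp
  \<comment> \<open>Rounding \<open>T\<close> up to an integer horizon costs at most 1, which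
    accounts for \<open>T + 1\<close> in the supremum.\<close>
  have k: "T \<le> real k" "real k \<le> T + 1" using T unfolding k_def by linarith+
  have fin_le: "running_sup \<alpha> r < \<infinity>" if "r \<le> T + 1" for r
    using running_sup_mono[OF that] fin by (rule le_less_trans)
  have reg: "regularized L r \<omega> = lim (\<lambda>n. L (dyadic_above n r) \<omega>)" if "r \<le> T" for r
  proof -
    have "real (nat \<lceil>r\<rceil>) \<le> T + 1" using that T by linarith
    then show ?thesis using fin_le by (simp add: regularized_def)
  qed
  have "\<bar>regularized L t \<omega> - regularized L s \<omega>\<bar>
    \<le> 32 * (3 + S') * (sqrt (t - s) * (sqrt (A + real k) + sqrt (ln (1 / (t - s)))))"
    unfolding reg[OF st(3)] reg[OF order_trans[OF less_imp_le[OF st(2)] st(3)]]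
  proof (rule dyadic_limit_modulus[where g="\<lambda>r. L r \<omega>"])
    show "L (real (Suc i) / 2 ^ n) \<omega> - L (real i / 2 ^ n) \<omega>
      \<le> 8 * (3 * (A + real n + real k) + S') / sqrt ((A + real n + real k) * 2 ^ n)" if "i < k * 2 ^ n" for n i
      using dyadic_increment_bound[OF S fin_le[OF k(2)] that] by (simp add: resolution_def A_def S'_def)
  qed (use mono st k in \<open>auto simp: A_def S'_def\<close>)
  also have "\<dots> \<le> 32 * (3 + S') * (sqrt (t - s) * ((1 + 1 / \<alpha> 0) * (sqrt ((T + 1) * R) + sqrt (ln (1 / (t - s))))))"
  proof (intro mult_left_mono)
    \<comment> \<open>\<open>A \<le> (T + 1) * R\<close>, and \<open>\<alpha> 0 \<le> R\<close>
      gives \<open>k \<le> T + 1 \<le> (T + 1) * R / \<alpha> 0\<close>; \<open>c\<close> adds the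
      two factors. Enlarging it to its square lets it leave the square root.\<close>
    define c where "c = 1 + 1 / \<alpha> 0"
    have a0: "0 < \<alpha> 0" by (rule \<alpha>_pos) simp
    have c: "1 \<le> c" using a0 by (simp add: c_def)
    have aR: "\<alpha> 0 \<le> R" unfolding R_def using fin T a0 by (intro le_running_sup) auto
    have AR: "A \<le> R" unfolding A_def R_def
      using running_sup_mono[OF k(2)] fin by (intro enn2real_mono) (auto simp: infinity_ennreal_def)
    have "R * 1 \<le> R * (T + 1)" using aR a0 T by (intro mult_left_mono) auto
    then have "A \<le> (T + 1) * R" using AR by (simp add: mult.commute)
    moreover have "real k \<le> (T + 1) * R * (1 / \<alpha> 0)"
    proof -
      have "(T + 1) * 1 \<le> (T + 1) * (R / \<alpha> 0)" using aR a0 T by (intro mult_left_mono) auto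
      then show ?thesis using k(2) by simp
    qed
    ultimately have "A + real k \<le> c * ((T + 1) * R)" by (simp add: c_def algebra_simps)
    also have "\<dots> \<le> c\<^sup>2 * ((T + 1) * R)"
      using c aR a0 T self_le_power[of c 2] by (intro mult_right_mono) auto
    finally have "sqrt (A + real k) \<le> sqrt (c\<^sup>2 * ((T + 1) * R))" by (rule real_sqrt_le_mono)
    also have "\<dots> = c * sqrt ((T + 1) * R)" using c by (simp add: real_sqrt_mult)
    finally have "sqrt (A + real k) \<le> c * sqrt ((T + 1) * R)" .
    moreover have "1 * sqrt (ln (1 / (t - s))) \<le> c * sqrt (ln (1 / (t - s)))"
      using c st by (intro mult_right_mono) auto
    ultimately show "sqrt (A + real k) + sqrt (ln (1 / (t - s)))
      \<le> (1 + 1 / \<alpha> 0) * (sqrt ((T + 1) * R) + sqrt (ln (1 / (t - s))))"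
      unfolding c_def[symmetric] distrib_left by linarith
  qed (use st in \<open>auto simp: S'_def\<close>)
  also have "\<dots> = 32 * (1 + 1 / \<alpha> 0) * (3 + S')
      * (sqrt (t - s) * sqrt ((T + 1) * R) + sqrt (t - s) * sqrt (ln (1 / (t - s))))"
    by (simp only: distrib_left mult_ac)
  finally show ?thesis by (simp add: R_def S'_def)
qed

lemma local_time_modulus:
  assumes L: "local_time M X x L"
  shows "\<exists>C :: 'a \<Rightarrow> ennreal. C \<in> borel_measurable M \<and> (AE \<omega> in M. C \<omega> < \<infinity>) \<and>
      (AE \<omega> in M. \<forall>s t T. 0 \<le> s \<and> s \<le> T \<and> 0 \<le> t \<and> t \<le> T \<and> \<bar>t - s\<bar> < 1 \<longrightarrow>
         ennreal \<bar>regularized L t \<omega> - regularized L s \<omega>\<bar>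
           \<le> C \<omega> * (ennreal (sqrt \<bar>t - s\<bar>) * esqrt (ennreal (T + 1) * running_sup \<alpha> (T + 1))
                    + ennreal (sqrt \<bar>t - s\<bar> * sqrt (ln (1 / \<bar>t - s\<bar>)))))"
proof -
  define c where "c = 32 * (1 + 1 / \<alpha> 0)"
  have c: "0 < c" using \<alpha>_pos[of 0] by (simp add: c_def add_pos_pos)
  define C where "C \<omega> = ennreal c * (3 + dyadic_sum L \<omega>)" for \<omega>
  note [measurable] = dyadic_sum_measurable[OF L]
  have "C \<in> borel_measurable M" unfolding C_def[abs_def] by measurable
  moreover have "AE \<omega> in M. C \<omega> < \<infinity>"
    using dyadic_sum_finite[OF L]
    by eventually_elim (simp add: C_def ennreal_mult_less_top less_top)
  moreover have "AE \<omega> in M. \<forall>s t T. 0 \<le> s \<and> s \<le> T \<and> 0 \<le> t \<and> t \<le> T \<and> \<bar>t - s\<bar> < 1 \<longrightarrow>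
         ennreal \<bar>regularized L t \<omega> - regularized L s \<omega>\<bar>
           \<le> C \<omega> * (ennreal (sqrt \<bar>t - s\<bar>) * esqrt (ennreal (T + 1) * running_sup \<alpha> (T + 1))
                    + ennreal (sqrt \<bar>t - s\<bar> * sqrt (ln (1 / \<bar>t - s\<bar>))))"
    using dyadic_sum_finite[OF L] AE_local_time_mono_dyadics[OF L]
  proof eventually_elim
    case (elim \<omega>)
    define S' where "S' = enn2real (dyadic_sum L \<omega>)"
    have S': "0 \<le> S'" by (simp add: S'_def)
    have "dyadic_sum L \<omega> = ennreal S'"
      unfolding S'_def using elim(1) by (simp add: less_top)
    then have C: "C \<omega> = ennreal (c * (3 + S'))"
      using c S' unfolding C_def
      by (simp add: ennreal_mult ennreal_plus flip: ennreal_numeral)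
    have main: "ennreal \<bar>regularized L t \<omega> - regularized L s \<omega>\<bar>
           \<le> C \<omega> * (ennreal (sqrt (t - s)) * esqrt (ennreal (T + 1) * running_sup \<alpha> (T + 1))
                    + ennreal (sqrt (t - s) * sqrt (ln (1 / (t - s)))))"
      if st: "0 \<le> s" "s < t" "t \<le> T" "t - s < 1" for s t T
    proof (cases "running_sup \<alpha> (T + 1) < \<infinity>")
      case True
      show ?thesis
        unfolding C
      proof (rule ennreal_le_esqrt_bound[OF _ _ _ _ True])
        show "\<bar>regularized L t \<omega> - regularized L s \<omega>\<bar> \<le> c * (3 + S')
          * (sqrt (t - s) * sqrt ((T + 1) * enn2real (running_sup \<alpha> (T + 1))) + sqrt (t - s) * sqrt (ln (1 / (t - s))))"
          using regularized_increment_bound[OF elim st True] by (simp add: c_def S'_def)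
      qed (use c S' st in auto)
    next
      case False
      \<comment> \<open>The right-hand side is infinite: \<open>t - s\<close>, \<open>T + 1\<close>
        and \<open>C \<omega>\<close> are all nonzero, so the convention for 0 times infinity does
        not intervene.\<close>
      then have "running_sup \<alpha> (T + 1) = top" by (metis infinity_ennreal_def less_top)
      then have "ennreal (sqrt (t - s)) * esqrt (ennreal (T + 1) * running_sup \<alpha> (T + 1)) = top"
        using st by (simp add: esqrt_def ennreal_mult_top infinity_ennreal_def)
      moreover have "C \<omega> \<noteq> 0" unfolding C using c S' by (simp add: ennreal_eq_0_iff not_le mult_pos_pos add_pos_nonneg)
      ultimately show ?thesis by (simp add: ennreal_mult_top)
    qed
    show ?case
    proof (intro allI impI)
      fix s t T :: real
      assume "0 \<le> s \<and> s \<le> T \<and> 0 \<le> t \<and> t \<le> T \<and> \<bar>t - s\<bar> < 1"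
      then show "ennreal \<bar>regularized L t \<omega> - regularized L s \<omega>\<bar>
           \<le> C \<omega> * (ennreal (sqrt \<bar>t - s\<bar>) * esqrt (ennreal (T + 1) * running_sup \<alpha> (T + 1))
                    + ennreal (sqrt \<bar>t - s\<bar> * sqrt (ln (1 / \<bar>t - s\<bar>))))"
        \<comment> \<open>For \<open>s = t\<close> the left-hand side is 0, so the value assigned to
          \<open>ln (1 / 0)\<close> is irrelevant.\<close>
        using main[of s t T] main[of t s T]
        by (cases s t rule: linorder_cases) (auto simp: abs_minus_commute)
    qed
  qed
  ultimately show ?thesis by blast
qed

end

section \<open>Reduction to everywhere continuous paths\<close>

theorem theorem4p1:
  fixes M :: "'a measure" and F :: "real \<Rightarrow> 'a measure"
    and W X L :: "real \<Rightarrow> 'a \<Rightarrow> real"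
    and \<alpha> :: "real \<Rightarrow> real" and x :: real
  assumes "complete_filtered_prob_space M F"
    and "brownian_motion M F W"
    and "\<And>t. 0 \<le> t \<Longrightarrow> 0 < \<alpha> t"
    and "\<alpha> \<in> borel_measurable (restrict_space borel {0..})"
    and "\<And>t. 0 \<le> t \<Longrightarrow> set_integrable lborel {0..t} \<alpha>"
    and "sde_solution M F W \<alpha> X"
    and "local_time M X x L"
  shows "\<exists>L'. modification M L L' \<and>
    (\<exists>C :: 'a \<Rightarrow> ennreal. C \<in> borel_measurable M \<and> (AE \<omega> in M. C \<omega> < \<infinity>) \<and>
      (AE \<omega> in M. \<forall>s t T. 0 \<le> s \<and> s \<le> T \<and> 0 \<le> t \<and> t \<le> T \<and> \<bar>t - s\<bar> < 1 \<longrightarrow>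
         ennreal \<bar>L' t \<omega> - L' s \<omega>\<bar>
           \<le> C \<omega> * (ennreal (sqrt \<bar>t - s\<bar>) * esqrt (ennreal (T + 1) * running_sup \<alpha> (T + 1))
                    + ennreal (sqrt \<bar>t - s\<bar> * sqrt (ln (1 / \<bar>t - s\<bar>))))))"
proof -
  interpret S: complete_filtered_prob_space M F by (rule assms(1))
  have cont: "AE \<omega> in M. continuous_on {0..} (\<lambda>t. X t \<omega>)"
    and X_eq: "AE \<omega> in M. \<forall>t\<ge>0. X t \<omega> = - (LINT r:{0..t}|lborel. \<alpha> r * X r \<omega>) + W t \<omega>"
    and X_ad: "\<And>t. 0 \<le> t \<Longrightarrow> X t \<in> borel_measurable (F t)"
    using assms(6) by (auto simp: sde_solution_def adapted_def)
  obtain N where N: "{\<omega> \<in> space M. \<not> continuous_on {0..} (\<lambda>t. X t \<omega>)} \<subseteq> N" "N \<in> null_sets M"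
    using AE_E2[OF cont] AE_E[OF cont] by (metis null_setsI)
  have N_F: "N \<in> sets (F t)" if "0 \<le> t" for t
    using N(2) S.null_sets_F S.sets_F_mono[of 0 t] that by auto
  \<comment> \<open>Every path of \<open>X'\<close> is continuous on the whole line; adaptedness survives because
    \<open>F 0\<close> contains the null sets.\<close>
  define X' where "X' t \<omega> = indicator (space M - N) \<omega> * X (max 0 t) \<omega>" for t \<omega>
  have X'_ad: "X' t \<in> borel_measurable (F t)" if "0 \<le> t" for t
  proof -
    have "space M - N \<in> sets (F t)"
      using N_F[OF that] S.subalgebra_F[OF that] sets.compl_sets[of N "F t"] by (simp add: subalgebra_def)
    then show ?thesis
      using X_ad[OF that] that unfolding X'_def[abs_def] by (simp add: max_def)
  qed
  have good: "AE \<omega> in M. \<omega> \<in> space M - N"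
    using AE_not_in[OF N(2)] by (auto intro: AE_mp[OF AE_space])
  have X'_X: "X' t \<omega> = X t \<omega>" if "\<omega> \<in> space M - N" "0 \<le> t" for t \<omega>
    using that by (simp add: X'_def max_def)
  interpret D: linear_drift_diffusion M F W X' \<alpha>
  proof unfold_locales
    show "X' t \<in> borel_measurable M" for t
    proof -
      have "X' t = X' (max 0 t)" by (auto simp: X'_def fun_eq_iff)
      then show ?thesis
        using measurable_from_subalg[OF S.subalgebra_F X'_ad, of "max 0 t"] by simp
    qed
    show "continuous_on UNIV (\<lambda>t. X' t \<omega>)" for \<omega>
    proof (cases "\<omega> \<in> space M - N")
      case True
      then have "continuous_on {0..} (\<lambda>t. X t \<omega>)" using N(1) by auto
      then have "continuous_on UNIV (\<lambda>t. X (max 0 t) \<omega>)"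
        by (rule continuous_on_compose2) (auto intro!: continuous_intros)
      then show ?thesis using True by (simp add: X'_def)
    qed (simp add: X'_def)
    show "AE \<omega> in M. \<forall>t\<ge>0. X' t \<omega> = - (LINT r:{0..t}|lborel. \<alpha> r * X' r \<omega>) + W t \<omega>"
      using X_eq good
    proof eventually_elim
      case (elim \<omega>)
      have "(LINT r:{0..t}|lborel. \<alpha> r * X' r \<omega>) = (LINT r:{0..t}|lborel. \<alpha> r * X r \<omega>)" for t
        using X'_X[OF elim(2)] by (intro set_lebesgue_integral_cong) auto
      then show ?case using elim X'_X[OF elim(2)] by simp
    qed
  qed (use assms(2,3,5) X'_ad S.subalgebra_F S.sets_F_mono in \<open>auto simp: brownian_motion_def adapted_def\<close>)
  \<comment> \<open>Off a null set \<open>X'\<close> and \<open>X\<close> agree at all nonnegative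
    times, so the mean square distances to \<open>L\<close> coincide.\<close>
  have "local_time M X' x L"
  proof -
    have "(\<integral>\<^sup>+\<omega>. ennreal (((LINT r:{0..t}|lborel. heat_kernel \<epsilon> (X' r \<omega> - x)) - L t \<omega>)\<^sup>2) \<partial>M)
      = (\<integral>\<^sup>+\<omega>. ennreal (((LINT r:{0..t}|lborel. heat_kernel \<epsilon> (X r \<omega> - x)) - L t \<omega>)\<^sup>2) \<partial>M)" for \<epsilon> t
    proof (rule nn_integral_cong_AE)
      show "AE \<omega> in M. ennreal (((LINT r:{0..t}|lborel. heat_kernel \<epsilon> (X' r \<omega> - x)) - L t \<omega>)\<^sup>2)
        = ennreal (((LINT r:{0..t}|lborel. heat_kernel \<epsilon> (X r \<omega> - x)) - L t \<omega>)\<^sup>2)"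
        using good
      proof eventually_elim
        case (elim \<omega>)
        have "(LINT r:{0..t}|lborel. heat_kernel \<epsilon> (X' r \<omega> - x)) = (LINT r:{0..t}|lborel. heat_kernel \<epsilon> (X r \<omega> - x))"
          using X'_X[OF elim] by (intro set_lebesgue_integral_cong) auto
        then show ?case by simp
      qed
    qed
    then show ?thesis using assms(7) by (simp add: local_time_def)
  qed
  from D.modification_regularized[OF this] D.local_time_modulus[OF this] show ?thesis
    by blast
qed

end
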